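(* Let $n\ge 1$, let $0<t<1$, and let $G\in\mathbb{R}[x_1,\dots,x_{n+1}]$ be a completely non-degenerate (nonzero) polynomial. Let $\mathcal{A}(G)=\mathrm{Log}_t(V(G))$ be its amoeba and $\mathcal{A}^{\mathbb{R}}(G)=\mathrm{Log}_t(\mathbb{R}V(G))$ its real amoeba. Then the total (logarithmic) curvatures satisfy $$\frac{\sigma_{2n}}{\sigma_n}\int_{\mathcal{A}^{\mathbb{R}}(G)}|k|\;\le\;\int_{\mathcal{A}(G)}|K| .$$
   Context: Constants: $\sigma_m$ is the volume of the unit sphere $S^m\subset\mathbb{R}^{m+1}$, and $a_n=\pi\,\sigma_{2n}/\sigma_{2n+1}$. $ds$ and $dp$ are the canonical volume forms on $\mathbb{RP}^n$ and $\mathbb{CP}^n$, normalised so that $\mathrm{vol}(\mathbb{RP}^n)=\sigma_n/2$ and $\mathrm{vol}(\mathbb{CP}^n)=\sigma_{2n+1}/\sigma_1$. For a polynomial $G$, $V(G)\subset(\mathbb{C}^* )^{n+1}$ is its zero set in the torus and $\mathbb{R}V(G)=V(G)\cap(\mathbb{R}^* )^{n+1}$. For a face $\delta$ (not necessarily proper) of the Newton polytope $\triangle_G$, $G^\delta$ is the truncation of $G$ to $\delta$ (keep only the monomials with exponent in $\delta$). $G$ is completely non-degenerate if for every face $\delta$ of $\triangle_G$ (including $\triangle_G$) the polynomial $G^\delta$ defines a non-singular variety in $(\mathbb{C}^* )^{n+1}$, i.e. $G^\delta$ and all $x_i\partial G^\delta/\partial x_i$ have no common zero in $(\mathbb{C}^*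 )^{n+1}$. $\mathrm{Log}_t(x)=(\log_t|x_1|,\dots,\log_t|x_{n+1}|)$. The logarithmic Gauss map is $\gamma:V(G)\to\mathbb{CP}^n$, $x\mapsto[x_1\frac{\partial G}{\partial x_1}:\dots:x_{n+1}\frac{\partial G}{\partial x_{n+1}}]$, and $\gamma^{\mathbb{R}}:\mathbb{R}V(G)\to\mathbb{RP}^n$ is its restriction to real points; it is the composition of $\mathrm{Log}_t$ with the Gauss map of the image. On each orthant of $(\mathbb{R}^* )^{n+1}$, $\mathrm{Log}_t$ is a diffeomorphism onto $\mathbb{R}^{n+1}$, and the total curvature of the real amoeba is counted orthant by orthant, i.e. $$\int_{\mathcal{A}^{\mathbb{R}}(G)}|k|=\int_{\mathbb{RP}^n}\#(\gamma^{\mathbb{R}})^{-1}(\beta)\,ds .$$ The total curvature of the complex amoeba is by definition $\int_{\mathcal{A}(G)}K=(-1)^n a_n\int_{\mathbb{CP}^n}\#\gamma^{-1}(\beta)\,dp$, and $\int_{\mathcal{A}(G)}|K|=(-1)^n\int_{\mathcal{A}(G)}K$. *)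

theory Defs
  imports "HOL-Analysis.Analysis" "HOL-Library.Poly_Mapping"
begin

section \<open>Polynomials in several variables\<close>

text \<open>
  A polynomial in variables indexed by the finite type \<open>'m\<close> is a finitely supported
  map from exponent vectors to coefficients.
\<close>

type_synonym ('m, 'a) mpoly = "('m \<Rightarrow>\<^sub>0 nat) \<Rightarrow>\<^sub>0 'a"

definition mpeval :: "('m::finite, real) mpoly \<Rightarrow> 'k::real_normed_field ^ 'm \<Rightarrow> 'k" where
  "mpeval G x =
     (\<Sum>\<alpha>\<in>Poly_Mapping.keys G.
        of_real (Poly_Mapping.lookup G \<alpha>) * (\<Prod>i\<in>UNIV. (x $ i) ^ Poly_Mapping.lookup \<alpha> i))"

definition partial_deriv ::
    "('m::finite, real) mpoly \<Rightarrow> 'm \<Rightarrow> 'k::real_normed_field ^ 'm \<Rightarrow> 'k" where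
  "partial_deriv G i x = deriv (\<lambda>z. mpeval G (\<chi> j. if j = i then z else x $ j)) (x $ i)"

definition exponent_point :: "('m::finite \<Rightarrow>\<^sub>0 nat) \<Rightarrow> real ^ 'm" where
  "exponent_point \<alpha> = (\<chi> i. real (Poly_Mapping.lookup \<alpha> i))"

definition newton_polytope :: "('m::finite, real) mpoly \<Rightarrow> (real ^ 'm) set" where
  "newton_polytope G = convex hull (exponent_point ` Poly_Mapping.keys G)"

definition truncation ::
    "('m::finite, real) mpoly \<Rightarrow> (real ^ 'm) set \<Rightarrow> ('m, real) mpoly" where
  "truncation G \<delta> =
     (\<Sum>\<alpha>\<in>{\<alpha> \<in> Poly_Mapping.keys G. exponent_point \<alpha> \<in> \<delta>}.
        Poly_Mapping.single \<alpha> (Poly_Mapping.lookup G \<alpha>))"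

lemma lookup_truncation:
  "Poly_Mapping.lookup (truncation G \<delta>) \<alpha> =
     (if exponent_point \<alpha> \<in> \<delta> then Poly_Mapping.lookup G \<alpha> else 0)"
proof -
  have "Poly_Mapping.lookup (truncation G \<delta>) \<alpha> =
      (\<Sum>\<beta>\<in>{\<beta> \<in> Poly_Mapping.keys G. exponent_point \<beta> \<in> \<delta>}.
         if \<beta> = \<alpha> then Poly_Mapping.lookup G \<beta> else 0)"
    unfolding truncation_def lookup_sum
    by (intro sum.cong) (auto simp: lookup_single when_def)
  also have "\<dots> = (if exponent_point \<alpha> \<in> \<delta> then Poly_Mapping.lookup G \<alpha> else 0)"
    by (auto simp: in_keys_iff)
  finally show ?thesis .
qed

definition torus :: "('k::zero ^ 'm) set" where
  "torus = {x. \<forall>i. x $ i \<noteq> 0}"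

definition torus_zeros :: "('m::finite, real) mpoly \<Rightarrow> ('k::real_normed_field ^ 'm) set" where
  "torus_zeros G = {x \<in> torus. mpeval G x = 0}"

text \<open>
  The library relation \<open>face_of\<close> counts the empty set as a face and the polytope itself
  as a face; only the former has to be excluded.
\<close>

definition completely_nondegenerate :: "('m::finite, real) mpoly \<Rightarrow> bool" where
  "completely_nondegenerate G \<longleftrightarrow>
     (\<forall>\<delta>. \<delta> face_of newton_polytope G \<longrightarrow> \<delta> \<noteq> {} \<longrightarrow>
        \<not> (\<exists>x \<in> (torus :: (complex ^ 'm) set).
              mpeval (truncation G \<delta>) x = 0 \<and>
              (\<forall>i. x $ i * partial_deriv (truncation G \<delta>) i x = 0)))"


section \<open>Projective spaces and their canonical volumes\<close>

definition sphere_vol :: "nat \<Rightarrow> real" where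
  "sphere_vol m = 2 * pi powr (real (m + 1) / 2) / Gamma (real (m + 1) / 2)"

text \<open>
  The surface measure of the unit sphere of a Euclidean space of dimension \<open>d\<close>: the area of a
  Borel set is \<open>d\<close> times the Lebesgue volume of the part of the unit ball lying over it
  (\<open>sgn\<close> is the radial projection).
\<close>

definition sphere_measure :: "'a::euclidean_space measure" where
  "sphere_measure =
     scale_measure (ennreal (real DIM('a)))
       (distr (restrict_space lborel (ball 0 1 - {0})) (restrict_space borel (sphere 0 1)) sgn)"

lemma sphere_vol_eq: "sphere_vol m = real (m + 1) * unit_ball_vol (real (m + 1))"
proof -
  define r :: real where "r = real (m + 1) / 2"
  have "r > 0"
    by (simp add: r_def)
  moreover have "Gamma (r + 1) = r * Gamma r"
    by (rule Gamma_plus1) (use \<open>r > 0\<close> in \<open>auto elim!: nonpos_Ints_cases\<close>)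
  ultimately have "2 * pi powr r / Gamma r = (2 * r) * (pi powr r / Gamma (r + 1))"
    using Gamma_real_pos[of r] by simp
  moreover have "2 * r = real (m + 1)"
    by (simp add: r_def)
  ultimately show ?thesis
    unfolding sphere_vol_def unit_ball_vol_def r_def[symmetric]
    by metis
qed

lemma sphere_vol_pos: "sphere_vol m > 0"
  unfolding sphere_vol_eq by (intro mult_pos_pos unit_ball_vol_pos) auto

lemma space_sphere_measure: "space sphere_measure = sphere 0 1"
  by (simp add: sphere_measure_def space_scale_measure space_restrict_space)

lemma sets_sphere_measure: "sets sphere_measure = sets (restrict_space borel (sphere 0 1))"
  by (simp add: sphere_measure_def)

lemma measurable_sgn_sphere:
  "sgn \<in> measurable (restrict_space lborel (ball 0 1 - {0 :: 'a :: euclidean_space}))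
                     (restrict_space borel (sphere 0 1))"
proof (rule measurable_restrict_space2)
  show "sgn \<in> borel_measurable (restrict_space lborel (ball 0 1 - {0 :: 'a}))"
    unfolding sgn_div_norm by (intro measurable_restrict_space1) measurable
qed (auto simp: space_restrict_space norm_sgn)

lemma emeasure_sphere_measure:
  "emeasure (sphere_measure :: 'a :: euclidean_space measure) (sphere 0 1)
     = ennreal (sphere_vol (DIM('a) - 1))"
proof -
  let ?B = "ball 0 1 - {0 :: 'a}"
  have "emeasure (distr (restrict_space lborel ?B) (restrict_space borel (sphere 0 1)) sgn) (sphere 0 1)
      = emeasure (restrict_space lborel ?B) (sgn -` sphere 0 1 \<inter> space (restrict_space lborel ?B))"
    by (rule emeasure_distr[OF measurable_sgn_sphere]) (auto simp: sets_restrict_space)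
  also have "sgn -` sphere 0 1 \<inter> space (restrict_space lborel ?B) = ?B"
    by (auto simp: space_restrict_space norm_sgn)
  also have "emeasure (restrict_space lborel ?B) ?B = emeasure lborel ?B"
    by (rule emeasure_restrict_space) auto
  also have "\<dots> = emeasure lborel (ball 0 1 :: 'a set)"
    by (subst emeasure_Diff) auto
  also have "\<dots> = ennreal (unit_ball_vol (real DIM('a)))"
    by (subst emeasure_ball) auto
  finally show ?thesis
    by (simp add: sphere_measure_def sphere_vol_eq ennreal_mult' DIM_positive)
qed

text \<open>
  Points of the projective space over \<open>'k\<close> are the lines through the origin of \<open>'k ^ 'm\<close>.
\<close>

definition proj_point :: "'k::field ^ 'm \<Rightarrow> ('k ^ 'm) set" where
  "proj_point v = range (\<lambda>c. c *s v)"

definition proj_space :: "('k::field ^ 'm) set set" where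
  "proj_space = proj_point ` (- {0})"

text \<open>
  The \<open>\<sigma>\<close>-algebra is the quotient one: a set of lines is measurable iff the unit vectors spanning
  these lines form a Borel set.
\<close>

definition proj_algebra :: "('k::{real_normed_field, euclidean_space} ^ 'm::finite) set measure" where
  "proj_algebra =
     sigma proj_space {A. A \<subseteq> proj_space \<and> {v \<in> sphere 0 1. proj_point v \<in> A} \<in> sets borel}"

text \<open>
  The map from the unit sphere of \<open>'k ^ 'm\<close> to the projective space is a Riemannian submersion for
  the canonical metric, whose fibres are isometric to the unit sphere of \<open>'k\<close>
  (two points if \<open>'k\<close> is \<open>real\<close>, great circles if \<open>'k\<close> is \<open>complex\<close>). The canonical volume is thus
  the image of the surface measure divided by the volume of that fibre; see
  \<open>emeasure_proj_measure_real\<close> and \<open>emeasure_proj_measure_complex\<close> below for the normalisation.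
\<close>

definition proj_measure :: "('k::{real_normed_field, euclidean_space} ^ 'm::finite) set measure" where
  "proj_measure =
     scale_measure (ennreal (1 / sphere_vol (DIM('k) - 1))) (distr sphere_measure proj_algebra proj_point)"

abbreviation real_proj_measure :: "(real ^ 'm::finite) set measure" where
  "real_proj_measure \<equiv> proj_measure"

abbreviation complex_proj_measure :: "(complex ^ 'm::finite) set measure" where
  "complex_proj_measure \<equiv> proj_measure"

lemma proj_point_in_proj_space: "v \<noteq> 0 \<Longrightarrow> proj_point v \<in> proj_space"
  by (simp add: proj_space_def)

lemma space_proj_algebra: "space proj_algebra = proj_space"
  by (simp add: proj_algebra_def space_measure_of_conv)

lemma space_proj_measure: "space proj_measure = proj_space"
  by (simp add: proj_measure_def space_scale_measure space_proj_algebra)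

lemma measurable_proj_point: "proj_point \<in> measurable sphere_measure proj_algebra"
  unfolding proj_algebra_def
proof (rule measurable_measure_of)
  show "proj_point \<in> space (sphere_measure :: ('a ^ 'b) measure) \<rightarrow> proj_space"
    by (auto simp: space_sphere_measure intro!: proj_point_in_proj_space)
next
  fix A :: "('a ^ 'b) set set"
  assume "A \<in> {A. A \<subseteq> proj_space \<and> {v \<in> sphere 0 1. proj_point v \<in> A} \<in> sets borel}"
  moreover have "proj_point -` A \<inter> space sphere_measure = sphere 0 1 \<inter> {v \<in> sphere 0 1. proj_point v \<in> A}"
    by (auto simp: space_sphere_measure)
  ultimately show "proj_point -` A \<inter> space sphere_measure \<in> sets sphere_measure"
    by (auto simp: sets_sphere_measure sets_restrict_space)
qed auto

lemma emeasure_proj_measure: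
  "emeasure (proj_measure :: ('k::{real_normed_field, euclidean_space} ^ 'm::finite) set measure) proj_space
     = ennreal (sphere_vol (DIM('k ^ 'm) - 1) / sphere_vol (DIM('k) - 1))"
proof -
  let ?S = "sphere_measure :: ('k ^ 'm) measure"
  have "emeasure (distr ?S proj_algebra proj_point) proj_space
      = emeasure ?S (proj_point -` proj_space \<inter> space ?S)"
    by (rule emeasure_distr[OF measurable_proj_point]) (subst space_proj_algebra[symmetric], rule sets.top)
  also have "proj_point -` proj_space \<inter> space ?S = sphere 0 1"
  proof -
    have "proj_point v \<in> proj_space" if "v \<in> sphere 0 1" for v :: "'k ^ 'm"
      by (rule proj_point_in_proj_space) (use that in force)
    thus ?thesis
      unfolding space_sphere_measure by blast
  qed
  finally have "emeasure (proj_measure :: ('k ^ 'm) set measure) proj_space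
      = ennreal (1 / sphere_vol (DIM('k) - 1)) * ennreal (sphere_vol (DIM('k ^ 'm) - 1))"
    by (simp only: proj_measure_def emeasure_scale_measure emeasure_sphere_measure)
  also have "\<dots> = ennreal (1 / sphere_vol (DIM('k) - 1) * sphere_vol (DIM('k ^ 'm) - 1))"
    by (rule ennreal_mult[symmetric]) (simp_all add: sphere_vol_pos less_imp_le)
  finally show ?thesis
    by simp
qed

lemma emeasure_proj_measure_real:
  assumes "CARD('m::finite) = n + 1"
  shows "emeasure (real_proj_measure :: (real ^ 'm) set measure) proj_space = ennreal (sphere_vol n / 2)"
proof -
  have "sphere_vol 0 = 2"
    by (simp add: sphere_vol_eq)
  thus ?thesis
    using assms by (simp add: emeasure_proj_measure)
qed

lemma emeasure_proj_measure_complex: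
  assumes "CARD('m::finite) = n + 1"
  shows "emeasure (complex_proj_measure :: (complex ^ 'm) set measure) proj_space
           = ennreal (sphere_vol (2 * n + 1) / sphere_vol 1)"
  using assms by (simp add: emeasure_proj_measure mult.commute)


section \<open>The logarithmic Gauss map and total curvatures\<close>

text \<open>
  With \<open>'k\<close> instantiated to \<open>complex\<close> these are the zero set in the complex torus and its logarithmic
  Gauss map; the instance \<open>real\<close> gives the real points and the restriction of the map to them.
\<close>

definition log_gauss ::
    "('m::finite, real) mpoly \<Rightarrow> 'k::real_normed_field ^ 'm \<Rightarrow> ('k ^ 'm) set" where
  "log_gauss G x = proj_point (\<chi> i. x $ i * partial_deriv G i x)"

text \<open>The number of elements of a set, with value \<open>\<infinity>\<close> for infinite sets.\<close>

definition num_elems :: "'a set \<Rightarrow> ennreal" where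
  "num_elems A = emeasure (count_space UNIV) A"

definition real_total_abs_curvature :: "('m::finite, real) mpoly \<Rightarrow> ereal" where
  "real_total_abs_curvature G =
     enn2ereal (\<integral>\<^sup>+ \<beta>. num_elems {x \<in> torus_zeros G. log_gauss G x = \<beta>} \<partial>real_proj_measure)"

definition curv_const :: "nat \<Rightarrow> real" where
  "curv_const n = pi * sphere_vol (2 * n) / sphere_vol (2 * n + 1)"

definition complex_total_curvature :: "('m::finite, real) mpoly \<Rightarrow> ereal" where
  "complex_total_curvature (G :: ('m, real) mpoly) =
     (let n = CARD('m) - 1 in
      (-1) ^ n * ereal (curv_const n) *
      enn2ereal (\<integral>\<^sup>+ \<beta>. num_elems {x \<in> torus_zeros G. log_gauss G x = \<beta>} \<partial>complex_proj_measure))"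

definition complex_total_abs_curvature :: "('m::finite, real) mpoly \<Rightarrow> ereal" where
  "complex_total_abs_curvature (G :: ('m, real) mpoly) =
     (-1) ^ (CARD('m) - 1) * complex_total_curvature G"


section \<open>Curvature and the real amoeba\<close>

text \<open>
  The total curvatures are expressed through the logarithmic Gauss map, so they do not depend on
  the base \<open>t\<close> of the logarithms. For the real amoeba, the following shows that this is what one
  gets by counting, orthant by orthant, the points of the real amoeba at which the Gauss map of the
  real amoeba (the gradient direction of a defining equation) takes a given value.
\<close>

definition Log_map :: "real \<Rightarrow> 'k::real_normed_field ^ 'm \<Rightarrow> real ^ 'm" where
  "Log_map t x = (\<chi> i. log t (norm (x $ i)))"

definition amoeba :: "real \<Rightarrow> ('m::finite, real) mpoly \<Rightarrow> (real ^ 'm) set" where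
  "amoeba t G = Log_map t ` (torus_zeros G :: (complex ^ 'm) set)"

definition real_amoeba :: "real \<Rightarrow> ('m::finite, real) mpoly \<Rightarrow> (real ^ 'm) set" where
  "real_amoeba t G = Log_map t ` (torus_zeros G :: (real ^ 'm) set)"

definition sign_vectors :: "(real ^ 'm::finite) set" where
  "sign_vectors = {s. \<forall>i. s $ i \<in> {-1, 1}}"

definition orthant :: "real ^ 'm \<Rightarrow> (real ^ 'm) set" where
  "orthant s = {x. \<forall>i. sgn (x $ i) = s $ i}"

definition real_amoeba_sheet :: "real \<Rightarrow> ('m::finite, real) mpoly \<Rightarrow> real ^ 'm \<Rightarrow> (real ^ 'm) set" where
  "real_amoeba_sheet t G s = Log_map t ` (torus_zeros G \<inter> orthant s)"

definition exp_map :: "real \<Rightarrow> real ^ 'm \<Rightarrow> real ^ 'm \<Rightarrow> real ^ 'm" where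
  "exp_map t s y = (\<chi> i. s $ i * t powr (y $ i))"

definition gauss_map :: "(real ^ 'm::finite \<Rightarrow> real) \<Rightarrow> real ^ 'm \<Rightarrow> (real ^ 'm) set" where
  "gauss_map h y = proj_point (\<chi> i. deriv (\<lambda>r. h (y + r *\<^sub>R axis i 1)) 0)"

lemma real_amoeba_eq_Union_sheets:
  "real_amoeba t G = (\<Union>s\<in>sign_vectors. real_amoeba_sheet t G s)"
proof -
  have "x \<in> orthant (\<chi> i. sgn (x $ i)) \<and> (\<chi> i. sgn (x $ i)) \<in> sign_vectors"
    if "x \<in> torus" for x :: "real ^ 'a"
    using that by (auto simp: orthant_def sign_vectors_def torus_def sgn_if)
  thus ?thesis
    unfolding real_amoeba_def real_amoeba_sheet_def torus_zeros_def by blast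
qed

lemma Log_map_exp_map:
  assumes "0 < t" "t < 1" "s \<in> sign_vectors"
  shows "Log_map t (exp_map t s y) = y"
proof -
  have "\<bar>s $ i\<bar> = 1" for i
    using assms(3) by (auto simp: sign_vectors_def dest!: spec[of _ i])
  thus ?thesis
    using assms(1,2) by (simp add: Log_map_def exp_map_def vec_eq_iff abs_mult)
qed

lemma exp_map_Log_map:
  assumes "0 < t" "t < 1" "s \<in> sign_vectors" "x \<in> orthant s"
  shows "exp_map t s (Log_map t x) = x"
proof -
  have "x $ i \<noteq> 0" for i
  proof -
    have "s $ i \<noteq> 0"
      using assms(3) by (auto simp: sign_vectors_def dest!: spec[of _ i])
    thus ?thesis
      using assms(4) by (auto simp: orthant_def dest!: spec[of _ i])
  qed
  moreover have "s $ i * \<bar>x $ i\<bar> = x $ i" for i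
  proof -
    have "s $ i = sgn (x $ i)"
      using assms(4) by (simp add: orthant_def)
    thus ?thesis
      by (simp only: sgn_mult_abs)
  qed
  moreover have "t powr log t \<bar>x $ i\<bar> = \<bar>x $ i\<bar>" if "x $ i \<noteq> 0" for i
    using assms(1,2) that by simp
  ultimately have "s $ i * t powr log t \<bar>x $ i\<bar> = x $ i" for i
    by metis
  thus ?thesis
    by (simp only: Log_map_def exp_map_def vec_eq_iff vec_lambda_beta real_norm_def) simp
qed

lemma has_partial_deriv:
  fixes G :: "('m::finite, real) mpoly"
  shows
  "((\<lambda>z. mpeval G (\<chi> j. if j = i then z else x $ j)) has_field_derivative partial_deriv G i x)
     (at (x $ i))"
proof -
  have "(\<lambda>z. \<Sum>\<alpha>\<in>Poly_Mapping.keys G. of_real (Poly_Mapping.lookup G \<alpha>) *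
          (\<Prod>j\<in>UNIV. (if j = i then z else x $ j) ^ Poly_Mapping.lookup \<alpha> j)) field_differentiable at (x $ i)"
  proof (intro field_differentiable_sum field_differentiable_mult field_differentiable_const)
    fix \<alpha> :: "'m \<Rightarrow>\<^sub>0 nat"
    have *: "(\<Prod>j\<in>UNIV. (if j = i then z else x $ j) ^ Poly_Mapping.lookup \<alpha> j)
        = z ^ Poly_Mapping.lookup \<alpha> i * (\<Prod>j\<in>UNIV-{i}. x $ j ^ Poly_Mapping.lookup \<alpha> j)" for z
      by (subst prod.remove[of _ i]) auto
    show "(\<lambda>z. \<Prod>j\<in>UNIV. (if j = i then z else x $ j) ^ Poly_Mapping.lookup \<alpha> j)
             field_differentiable at (x $ i)"
      unfolding * by (intro derivative_intros field_differentiable_mult field_differentiable_const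
          field_differentiable_power field_differentiable_ident)
  qed
  thus ?thesis
    unfolding partial_deriv_def mpeval_def by (simp add: DERIV_deriv_iff_field_differentiable)
qed

lemma gauss_map_exp_map:
  fixes G :: "('m::finite, real) mpoly"
  assumes "0 < t" "t < 1"
  shows "gauss_map (\<lambda>y. mpeval G (exp_map t s y)) y = log_gauss G (exp_map t s y)"
proof -
  let ?x = "exp_map t s y"
  have "deriv (\<lambda>r. mpeval G (exp_map t s (y + r *\<^sub>R axis i 1))) 0 = ln t * (?x $ i * partial_deriv G i ?x)"
    for i
  proof -
    have *: "exp_map t s (y + r *\<^sub>R axis i 1) = (\<chi> j. if j = i then s $ i * t powr (y $ i + r) else ?x $ j)" for r
      by (simp add: vec_eq_iff exp_map_def axis_def)
    have "((\<lambda>r. s $ i * t powr (y $ i + r)) has_field_derivative s $ i * (t powr (y $ i) * ln t)) (at 0)"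
      using assms by (auto intro!: derivative_eq_intros)
    moreover have "s $ i * t powr (y $ i + 0) = ?x $ i"
      by (simp add: exp_map_def)
    ultimately have "((\<lambda>r. mpeval G (\<chi> j. if j = i then s $ i * t powr (y $ i + r) else ?x $ j))
        has_field_derivative partial_deriv G i ?x * (s $ i * (t powr (y $ i) * ln t))) (at 0)"
      by (intro DERIV_chain2[where f = "\<lambda>z. mpeval G (\<chi> j. if j = i then z else ?x $ j)"])
         (simp_all only: has_partial_deriv)
    thus ?thesis
      unfolding * by (simp add: DERIV_imp_deriv exp_map_def mult_ac)
  qed
  hence "gauss_map (\<lambda>y. mpeval G (exp_map t s y)) y
      = proj_point (ln t *s (\<chi> i. ?x $ i * partial_deriv G i ?x))"
    by (simp add: gauss_map_def vector_scalar_mult_def)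
  also have "\<dots> = proj_point (\<chi> i. ?x $ i * partial_deriv G i ?x)"
  proof -
    have "ln t \<noteq> 0"
      using assms by simp
    hence "\<exists>c'. c *s v = (c' * ln t) *s v" for c and v :: "real ^ 'm"
      by (intro exI[of _ "c / ln t"]) simp
    thus ?thesis
      unfolding proj_point_def by (auto simp: image_iff vector_smult_assoc)
  qed
  finally show ?thesis
    by (simp add: log_gauss_def)
qed

lemma num_elems_real_fibre:
  fixes G :: "('m::finite, real) mpoly"
  assumes "0 < t" "t < 1"
  shows "num_elems {x \<in> torus_zeros G. log_gauss G x = \<beta>}
    = (\<Sum>s\<in>sign_vectors.
         num_elems {y \<in> real_amoeba_sheet t G s. gauss_map (\<lambda>y. mpeval G (exp_map t s y)) y = \<beta>})"
proof -
  let ?F = "\<lambda>s :: real ^ 'm. {x \<in> torus_zeros G \<inter> orthant s. log_gauss G x = \<beta>}"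
  have "finite (PiE (UNIV :: 'm set) (\<lambda>_. {-1, 1 :: real}))"
    by (rule finite_PiE) auto
  moreover have "sign_vectors \<subseteq> vec_lambda ` PiE (UNIV :: 'm set) (\<lambda>_. {-1, 1 :: real})"
  proof
    fix s :: "real ^ 'm" assume "s \<in> sign_vectors"
    hence "vec_nth s \<in> PiE UNIV (\<lambda>_. {-1, 1})"
      by (auto simp: sign_vectors_def)
    thus "s \<in> vec_lambda ` PiE UNIV (\<lambda>_. {-1, 1})"
      by (metis image_eqI vec_nth_inverse)
  qed
  ultimately have fin: "finite (sign_vectors :: (real ^ 'm) set)"
    by (meson finite_surj)
  have "x \<in> orthant (\<chi> i. sgn (x $ i)) \<and> (\<chi> i. sgn (x $ i)) \<in> sign_vectors"
    if "x \<in> torus" for x :: "real ^ 'm"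
    using that by (auto simp: orthant_def sign_vectors_def torus_def sgn_if)
  hence "{x \<in> torus_zeros G. log_gauss G x = \<beta>} = (\<Union>s\<in>sign_vectors. ?F s)"
    unfolding torus_zeros_def by blast
  moreover have "disjoint_family_on ?F sign_vectors"
    by (auto simp: disjoint_family_on_def orthant_def vec_eq_iff)
  ultimately have "num_elems {x \<in> torus_zeros G. log_gauss G x = \<beta>} = (\<Sum>s\<in>sign_vectors. num_elems (?F s))"
    using fin by (simp add: num_elems_def sum_emeasure)
  also have "\<dots> = (\<Sum>s\<in>sign_vectors.
      num_elems {y \<in> real_amoeba_sheet t G s. gauss_map (\<lambda>y. mpeval G (exp_map t s y)) y = \<beta>})"
  proof (rule sum.cong)
    fix s :: "real ^ 'm" assume s: "s \<in> sign_vectors"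
    let ?Y = "{y \<in> real_amoeba_sheet t G s. gauss_map (\<lambda>y. mpeval G (exp_map t s y)) y = \<beta>}"
    have "?Y = Log_map t ` ?F s"
      using exp_map_Log_map[OF assms s]
      by (auto simp: real_amoeba_sheet_def gauss_map_exp_map[OF assms])
    moreover have "inj_on (Log_map t) (?F s)"
      by (rule inj_on_inverseI[of _ "exp_map t s"]) (use exp_map_Log_map[OF assms s] in auto)
    ultimately have "bij_betw (Log_map t) (?F s) ?Y"
      by (simp add: bij_betw_def)
    hence "finite (?F s) = finite ?Y" "card (?F s) = card ?Y"
      by (auto simp: bij_betw_finite bij_betw_same_card)
    thus "num_elems (?F s) = num_elems ?Y"
      by (simp add: num_elems_def emeasure_count_space)
  qed auto
  finally show ?thesis .
qed

lemma real_total_abs_curvature_orthantwise: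
  fixes G :: "('m::finite, real) mpoly"
  assumes "0 < t" "t < 1"
  shows "real_total_abs_curvature G = enn2ereal (\<integral>\<^sup>+ \<beta>. (\<Sum>s\<in>sign_vectors.
     num_elems {y \<in> real_amoeba_sheet t G s. gauss_map (\<lambda>y. mpeval G (exp_map t s y)) y = \<beta>})
     \<partial>real_proj_measure)"
  unfolding real_total_abs_curvature_def num_elems_real_fibre[OF assms] ..

end

theory Submission
  imports Defs "HOL-Computational_Algebra.Fundamental_Theorem_Algebra"
begin

text \<open>
  The fibre of the logarithmic Gauss map over the line spanned by \<open>w\<close> is given by polynomial
  equations over the coefficients of \<open>G\<close> and the coordinates of \<open>w\<close>. Call \<open>w\<close> generic if its
  coordinates are algebraically independent over the ring generated by the coefficients.
  If \<open>w\<close> and \<open>w'\<close> are both generic, then \<open>w \<mapsto> w'\<close> defines an isomorphism, fixing the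
  coefficients, of the rings that they generate together with the coordinates of \<open>w\<close> and of \<open>w'\<close>. Since \<open>\<complex>\<close> is algebraically
  closed and uncountable, this isomorphism of countable rings extends to any finitely many further
  complex numbers (\<open>partial_iso_extend\<close>), in particular to the coordinates of finitely many points of the
  fibre over \<open>w\<close>, and it carries these points to as many points of the fibre over \<open>w'\<close>
  (\<open>fibre_transfer\<close>). Hence all generic fibres have the same number \<open>N\<close> of points.

  Genericity is defined by countably many polynomials, each of which is nonzero off a null set,
  both on \<open>\<complex>^m\<close> and on \<open>\<real>^m\<close>. So almost every complex line contains a generic vector
  and has exactly \<open>N\<close> points over it, while almost every real line contains a real vector that
  is generic in \<open>\<complex>^m\<close> and so has at most \<open>N\<close> real points over it (\<open>generic_fibre_count\<close>).

  Integrating gives at most \<open>N\<close> times the volume of the real projective space on one side and exactly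
  \<open>N\<close> times the volume of the complex one on the other side. With the normalising constants both
  become \<open>N \<sigma>\<close> divided by \<open>2\<close>, where \<open>\<sigma>\<close> is the volume of the sphere of dimension \<open>2 n\<close>.
\<close>


section \<open>Extending isomorphisms between countable subrings of the complex numbers\<close>

text \<open>
  An isomorphism between two subrings of \<open>\<complex>\<close>, given by its graph. Keeping the graph rather than a
  function makes source and target interchangeable, and the requirement that a pair vanishes in
  both coordinates or in none says at once that the graph is single-valued and injective.
\<close>

locale partial_iso =
  fixes R :: "(complex \<times> complex) set"
  assumes one: "(1, 1) \<in> R"
    and add: "(x, y) \<in> R \<Longrightarrow> (x', y') \<in> R \<Longrightarrow> (x + x', y + y') \<in> R"
    and mult: "(x, y) \<in> R \<Longrightarrow> (x', y') \<in> R \<Longrightarrow> (x * x', y * y') \<in> R"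
    and uminus: "(x, y) \<in> R \<Longrightarrow> (- x, - y) \<in> R"
    and zero_iff: "(x, y) \<in> R \<Longrightarrow> x = 0 \<longleftrightarrow> y = 0"

text \<open>
  The induced isomorphism between the polynomial rings over source and target.
\<close>

definition poly_pairs :: "(complex \<times> complex) set \<Rightarrow> (complex poly \<times> complex poly) set" where
  "poly_pairs R = {(P, Q). \<forall>i. (coeff P i, coeff Q i) \<in> R}"

lemma partial_iso_converse: "partial_iso R \<Longrightarrow> partial_iso (R\<inverse>)"
  by (auto simp: partial_iso_def)

lemma poly_pairs_converse: "(Q, P) \<in> poly_pairs (R\<inverse>) \<longleftrightarrow> (P, Q) \<in> poly_pairs R"
  by (simp add: poly_pairs_def)

lemma countable_poly_pairs:
  assumes "countable R"
  shows "countable (poly_pairs R)"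
proof (rule countable_subset)
  let ?f = "\<lambda>xs. (Poly (map fst xs), Poly (map snd xs))"
  show "poly_pairs R \<subseteq> ?f ` lists R"
  proof
    fix z assume "z \<in> poly_pairs R"
    then obtain P Q where z: "z = (P, Q)" and PQ: "(coeff P i, coeff Q i) \<in> R" for i
      by (auto simp: poly_pairs_def)
    let ?xs = "map (\<lambda>i. (coeff P i, coeff Q i)) [0..<Suc (max (degree P) (degree Q))]"
    have "?xs \<in> lists R"
      using PQ by auto
    moreover have "z = ?f ?xs"
      unfolding z by (auto intro!: poly_eqI simp: coeff_Poly_eq nth_default_def coeff_eq_0 o_def simp del: upt_Suc)
    ultimately show "z \<in> ?f ` lists R"
      by (rule rev_image_eqI)
  qed
  show "countable (?f ` lists R)"
    using assms by (intro countable_image countable_lists)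
qed

context partial_iso
begin

lemma zero: "(0, 0) \<in> R"
  using add[OF one uminus[OF one]] by simp

lemma diff: "(x, y) \<in> R \<Longrightarrow> (x', y') \<in> R \<Longrightarrow> (x - x', y - y') \<in> R"
  using add[OF _ uminus] by fastforce

lemma sum: "(\<And>i. i \<in> A \<Longrightarrow> (f i, g i) \<in> R) \<Longrightarrow> (\<Sum>i\<in>A. f i, \<Sum>i\<in>A. g i) \<in> R"
  by (induction A rule: infinite_finite_induct) (auto intro: zero add)

lemma prod: "(\<And>i. i \<in> A \<Longrightarrow> (f i, g i) \<in> R) \<Longrightarrow> (\<Prod>i\<in>A. f i, \<Prod>i\<in>A. g i) \<in> R"
  by (induction A rule: infinite_finite_induct) (auto intro: one mult)

lemma power: "(x, y) \<in> R \<Longrightarrow> (x ^ k, y ^ k) \<in> R"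
  by (induction k) (auto intro: one mult)

lemma of_nat: "(of_nat k, of_nat k) \<in> R"
  by (induction k) (auto intro: zero one add)

lemma eq_iff: "(x, y) \<in> R \<Longrightarrow> (x', y') \<in> R \<Longrightarrow> x = x' \<longleftrightarrow> y = y'"
  using zero_iff[OF diff] by fastforce

lemma poly_pairs_coeff_eq_0_iff: "(P, Q) \<in> poly_pairs R \<Longrightarrow> coeff P i = 0 \<longleftrightarrow> coeff Q i = 0"
  using zero_iff by (auto simp: poly_pairs_def)

lemma poly_pairs_degree: "(P, Q) \<in> poly_pairs R \<Longrightarrow> degree P = degree Q"
  by (intro antisym degree_le) (metis coeff_eq_0 poly_pairs_coeff_eq_0_iff)+

lemma poly_pairs_const: "(x, y) \<in> R \<Longrightarrow> ([:x:], [:y:]) \<in> poly_pairs R"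
  by (auto simp: poly_pairs_def coeff_pCons zero split: nat.split)

lemma poly_pairs_monom: "(x, y) \<in> R \<Longrightarrow> (monom x k, monom y k) \<in> poly_pairs R"
  by (auto simp: poly_pairs_def zero)

lemma poly_pairs_add:
  "(P, Q) \<in> poly_pairs R \<Longrightarrow> (P', Q') \<in> poly_pairs R \<Longrightarrow> (P + P', Q + Q') \<in> poly_pairs R"
  by (auto simp: poly_pairs_def add)

lemma poly_pairs_diff:
  "(P, Q) \<in> poly_pairs R \<Longrightarrow> (P', Q') \<in> poly_pairs R \<Longrightarrow> (P - P', Q - Q') \<in> poly_pairs R"
  by (auto simp: poly_pairs_def diff)

lemma poly_pairs_mult:
  "(P, Q) \<in> poly_pairs R \<Longrightarrow> (P', Q') \<in> poly_pairs R \<Longrightarrow> (P * P', Q * Q') \<in> poly_pairs R"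
  by (auto simp: poly_pairs_def coeff_mult intro!: sum mult)

lemma poly_pairs_uminus: "(P, Q) \<in> poly_pairs R \<Longrightarrow> (- P, - Q) \<in> poly_pairs R"
  by (auto simp: poly_pairs_def uminus)

lemma poly_pairs_eq_0_iff: "(P, Q) \<in> poly_pairs R \<Longrightarrow> P = 0 \<longleftrightarrow> Q = 0"
  by (simp add: poly_eq_iff poly_pairs_coeff_eq_0_iff)

text \<open>
  Source and target are rings that need not be fields, so division with remainder is only possible
  after scaling the dividend. The leading coefficients of corresponding polynomials correspond, so
  one elimination step can be performed on both sides simultaneously.
\<close>

lemma poly_pairs_pseudo_divide:
  assumes "(M, N) \<in> poly_pairs R" "M \<noteq> 0" "(P, Q) \<in> poly_pairs R"
  shows "\<exists>a b S S' T T'. (a, b) \<in> R \<and> a \<noteq> 0 \<and>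
    (S, S') \<in> poly_pairs R \<and> (T, T') \<in> poly_pairs R \<and>
    smult a P = M * S + T \<and> smult b Q = N * S' + T' \<and> (T = 0 \<or> degree T < degree M)"
  using assms(3)
proof (induction "degree P" arbitrary: P Q rule: less_induct)
  case less
  note MN = assms(1)
  show ?case
  proof (cases "P = 0 \<or> degree P < degree M")
    case True
    have "(0, 0) \<in> poly_pairs R"
      by (simp add: poly_pairs_def zero)
    thus ?thesis
      using True less.prems one
      by (intro exI[of _ 1] exI[of _ 1] exI[of _ 0] exI[of _ 0] exI[of _ P] exI[of _ Q]) simp
  next
    case False
    define k where "k = degree P - degree M"
    define P' where "P' = smult (lead_coeff M) P - monom (lead_coeff P) k * M"
    define Q' where "Q' = smult (lead_coeff N) Q - monom (lead_coeff Q) k * N"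
    have lc: "(lead_coeff M, lead_coeff N) \<in> R" "(lead_coeff P, lead_coeff Q) \<in> R"
      using MN less.prems poly_pairs_degree[OF MN] poly_pairs_degree[OF less.prems]
      by (auto simp: poly_pairs_def)
    have PQ': "(P', Q') \<in> poly_pairs R"
      unfolding P'_def Q'_def
      using poly_pairs_mult[OF poly_pairs_const[OF lc(1)] less.prems]
        poly_pairs_mult[OF poly_pairs_monom[OF lc(2)] MN]
      by (auto intro!: poly_pairs_diff)
    \<comment> \<open>Between constants the cancellation does not lower the degree, which is already \<open>0\<close>.\<close>
    show ?thesis
    proof (cases "degree P = 0")
      case True
      hence "degree M = 0"
        using False by auto
      hence "smult (lead_coeff M) P = M * P"
        by (metis degree_0_id mult_smult_left mult.left_neutral smult_one)
      moreover have "smult (lead_coeff N) Q = N * Q"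
        using \<open>degree M = 0\<close> poly_pairs_degree[OF MN]
        by (metis degree_0_id mult_smult_left mult.left_neutral smult_one)
      moreover have "(0, 0) \<in> poly_pairs R"
        by (simp add: poly_pairs_def zero)
      ultimately show ?thesis
        using lc(1) assms(2) less.prems
        by (intro exI[of _ "lead_coeff M"] exI[of _ "lead_coeff N"] exI[of _ P] exI[of _ Q]
            exI[of _ 0]) auto
    next
      case pos: False
      have "degree P' < degree P"
      proof -
        have "degree P' \<le> degree P"
          unfolding P'_def
        proof (rule degree_diff_le)
          show "degree (monom (lead_coeff P) k * M) \<le> degree P"
            using degree_mult_le[of "monom (lead_coeff P) k" M] degree_monom_le[of "lead_coeff P" k]
              False unfolding k_def by linarith
        qed auto
        moreover have "coeff P' (degree P) = 0"
          using False by (simp add: P'_def k_def coeff_monom_mult)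
        ultimately show ?thesis
          using pos by (metis eq_zero_or_degree_less degree_0 gr0I)
      qed
      from less.hyps[OF this PQ'] obtain a b S S' T T' where *:
        "(a, b) \<in> R" "a \<noteq> 0" "(S, S') \<in> poly_pairs R" "(T, T') \<in> poly_pairs R"
        "smult a P' = M * S + T" "smult b Q' = N * S' + T'" "T = 0 \<or> degree T < degree M"
        by blast
      let ?S = "S + [:a:] * monom (lead_coeff P) k" and ?S' = "S' + [:b:] * monom (lead_coeff Q) k"
      have "(?S, ?S') \<in> poly_pairs R"
        using * lc by (intro poly_pairs_add poly_pairs_mult poly_pairs_const poly_pairs_monom)
      moreover have "smult (a * lead_coeff M) P = M * ?S + T"
        using *(5) by (simp add: P'_def smult_diff_right algebra_simps)
      moreover have "smult (b * lead_coeff N) Q = N * ?S' + T'"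
        using *(6) by (simp add: Q'_def smult_diff_right algebra_simps)
      moreover have "(a * lead_coeff M, b * lead_coeff N) \<in> R"
        using * lc by (intro mult)
      moreover have "a * lead_coeff M \<noteq> 0"
        using *(2) assms(2) by simp
      ultimately show ?thesis
        using *(4,7) by blast
    qed
  qed
qed

text \<open>
  Pseudo-division by a polynomial of least degree vanishing at \<open>c\<close> leaves no remainder; the same
  holds on the other side, where the divisor vanishes at \<open>d\<close>.
\<close>

lemma poly_pairs_vanish_transfer:
  assumes MN: "(M, N) \<in> poly_pairs R" "M \<noteq> 0" "poly M c = 0" "poly N d = 0"
    and min: "\<And>P Q. (P, Q) \<in> poly_pairs R \<Longrightarrow> P \<noteq> 0 \<Longrightarrow> poly P c = 0 \<Longrightarrow> degree M \<le> degree P"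
    and PQ: "(P, Q) \<in> poly_pairs R" "poly P c = 0"
  shows "poly Q d = 0"
proof -
  obtain a b S S' T T' where *:
    "(a, b) \<in> R" "a \<noteq> 0" "(S, S') \<in> poly_pairs R" "(T, T') \<in> poly_pairs R"
    "smult a P = M * S + T" "smult b Q = N * S' + T'" "T = 0 \<or> degree T < degree M"
    using poly_pairs_pseudo_divide[OF MN(1,2) PQ(1)] by blast
  have "poly T c = a * poly P c - poly M c * poly S c"
    using arg_cong[OF *(5), of "\<lambda>p. poly p c"] by simp
  hence "poly T c = 0"
    using MN(3) PQ(2) by simp
  hence "T = 0"
    using *(7) min[OF *(4)] by force
  hence "T' = 0"
    using poly_pairs_eq_0_iff[OF *(4)] by simp
  hence "b * poly Q d = 0"
    using arg_cong[OF *(6), of "\<lambda>p. poly p d"] MN(4) by simp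
  thus ?thesis
    using *(2) zero_iff[OF *(1)] by simp
qed

text \<open>
  For \<open>c\<close> algebraic over the source, take for \<open>d\<close> any root of the polynomial \<open>N\<close> corresponding to a
  minimal polynomial \<open>M\<close> of \<open>c\<close>. Then \<open>poly_pairs_vanish_transfer\<close> gives one implication. For the other one, let
  \<open>N'\<close> be a minimal polynomial of \<open>d\<close> and \<open>M'\<close> its counterpart. Then \<open>M'\<close> divides a
  multiple of \<open>M\<close> by a constant. If \<open>M'\<close> did not vanish at \<open>c\<close>, the cofactor would, and by the minimality
  of \<open>M\<close> the polynomials \<open>M'\<close> and \<open>N'\<close> would be constant, although \<open>N'\<close> vanishes at \<open>d\<close>.
  So \<open>M'\<close> vanishes at \<open>c\<close>, and the same lemma applies to the inverse isomorphism.
\<close>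

lemma conjugate_exists_algebraic:
  assumes "(P0, Q0) \<in> poly_pairs R" "P0 \<noteq> 0" "poly P0 c = 0"
  shows "\<exists>d. \<forall>(P, Q) \<in> poly_pairs R. poly P c = 0 \<longleftrightarrow> poly Q d = 0"
proof -
  let ?I = "\<lambda>(P, Q). (P, Q) \<in> poly_pairs R \<and> P \<noteq> 0 \<and> poly P c = 0"
  obtain M N where MN: "(M, N) \<in> poly_pairs R" "M \<noteq> 0" "poly M c = 0"
    and min: "\<And>P Q. (P, Q) \<in> poly_pairs R \<Longrightarrow> P \<noteq> 0 \<Longrightarrow> poly P c = 0 \<Longrightarrow> degree M \<le> degree P"
    using ex_has_least_nat[of ?I "(P0, Q0)" "\<lambda>(P, Q). degree P"] assms by force
  have "degree M \<noteq> 0"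
  proof
    assume "degree M = 0"
    then obtain a where "M = [:a:]"
      by (rule degree_eq_zeroE)
    thus False
      using MN(2,3) by simp
  qed
  hence "\<not> constant (poly N)"
    using poly_pairs_degree[OF MN(1)] by (simp add: constant_degree)
  then obtain d where d: "poly N d = 0"
    using fundamental_theorem_of_algebra by blast
  interpret inv: partial_iso "R\<inverse>"
    by (rule partial_iso_converse) (rule partial_iso_axioms)
  let ?I' = "\<lambda>(P, Q). (P, Q) \<in> poly_pairs R \<and> Q \<noteq> 0 \<and> poly Q d = 0"
  have "N \<noteq> 0"
    using poly_pairs_eq_0_iff[OF MN(1)] MN(2) by simp
  then obtain M' N' where MN': "(M', N') \<in> poly_pairs R" "N' \<noteq> 0" "poly N' d = 0"
    and min': "\<And>P Q. (P, Q) \<in> poly_pairs R \<Longrightarrow> Q \<noteq> 0 \<Longrightarrow> poly Q d = 0 \<Longrightarrow> degree N' \<le> degree Q"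
    using ex_has_least_nat[of ?I' "(M, N)" "\<lambda>(P, Q). degree Q"] MN(1) d by force
  have "M' \<noteq> 0"
    using poly_pairs_eq_0_iff[OF MN'(1)] MN'(2) by simp
  then obtain a b S S' T T' where *:
    "(a, b) \<in> R" "a \<noteq> 0" "(S, S') \<in> poly_pairs R" "(T, T') \<in> poly_pairs R"
    "smult a M = M' * S + T" "smult b N = N' * S' + T'" "T = 0 \<or> degree T < degree M'"
    using poly_pairs_pseudo_divide[OF MN'(1) _ MN(1)] by blast
  have "poly T' d = 0"
    using arg_cong[OF *(6), of "\<lambda>p. poly p d"] d MN'(3) by simp
  hence T: "T = 0"
    using *(7) min'[OF *(4)] poly_pairs_eq_0_iff[OF *(4)] poly_pairs_degree[OF *(4)]
      poly_pairs_degree[OF MN'(1)] by force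
  have "poly M' c = 0"
  proof (rule ccontr)
    assume "poly M' c \<noteq> 0"
    moreover have "poly M' c * poly S c = 0"
      using arg_cong[OF *(5), of "\<lambda>p. poly p c"] T MN(3) by simp
    moreover have "S \<noteq> 0"
      using *(2,5) T MN(2) by auto
    ultimately have "degree M \<le> degree S"
      using min[OF *(3)] by auto
    moreover have "degree M = degree M' + degree S"
      using arg_cong[OF *(5), of degree] T *(2) \<open>M' \<noteq> 0\<close> \<open>S \<noteq> 0\<close> by (simp add: degree_mult_eq)
    ultimately have "degree N' = 0"
      using poly_pairs_degree[OF MN'(1)] by simp
    then obtain a where "N' = [:a:]"
      by (rule degree_eq_zeroE)
    thus False
      using MN'(2,3) by simp
  qed
  hence "poly P c = 0" if "(P, Q) \<in> poly_pairs R" "poly Q d = 0" for P Q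
    using inv.poly_pairs_vanish_transfer[of N' M' d c Q P] MN' min' that
    by (auto simp: poly_pairs_converse)
  moreover have "poly Q d = 0" if "(P, Q) \<in> poly_pairs R" "poly P c = 0" for P Q
    using poly_pairs_vanish_transfer[OF MN d min that] .
  ultimately show ?thesis
    by blast
qed

text \<open>
  A countable ring has only countably many algebraic numbers over it, so the target leaves room
  for a transcendental image.
\<close>

lemma conjugate_exists_transcendental:
  assumes "countable R"
    and "\<And>P Q. (P, Q) \<in> poly_pairs R \<Longrightarrow> P \<noteq> 0 \<Longrightarrow> poly P c \<noteq> 0"
  shows "\<exists>d. \<forall>(P, Q) \<in> poly_pairs R. poly P c = 0 \<longleftrightarrow> poly Q d = 0"
proof -
  have "countable (\<Union>Q \<in> snd ` poly_pairs R - {0}. {z. poly Q z = 0})"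
    using countable_poly_pairs[OF assms(1)]
    by (intro countable_UN countable_Diff countable_image) (auto intro: countable_finite poly_roots_finite)
  then obtain d where "d \<notin> (\<Union>Q \<in> snd ` poly_pairs R - {0}. {z. poly Q z = 0})"
    using uncountable_UNIV_complex by (metis UNIV_eq_I)
  hence d: "poly Q d \<noteq> 0" if "(P, Q) \<in> poly_pairs R" "Q \<noteq> 0" for P Q
    using that by force
  have "poly P c = 0 \<longleftrightarrow> poly Q d = 0" if "(P, Q) \<in> poly_pairs R" for P Q
    using assms(2)[OF that] d[OF that] poly_pairs_eq_0_iff[OF that] by (cases "P = 0") auto
  thus ?thesis by blast
qed

text \<open>
  The isomorphism extends to the ring generated by \<open>c\<close>: evaluating corresponding polynomials at
  \<open>c\<close> and \<open>d\<close> is well defined and injective because they vanish there simultaneously.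
\<close>

lemma extend_one:
  assumes "countable R"
  shows "\<exists>d R'. partial_iso R' \<and> countable R' \<and> R \<subseteq> R' \<and> (c, d) \<in> R'"
proof -
  have "\<exists>d. \<forall>(P, Q) \<in> poly_pairs R. poly P c = 0 \<longleftrightarrow> poly Q d = 0"
  proof (cases "\<exists>P Q. (P, Q) \<in> poly_pairs R \<and> P \<noteq> 0 \<and> poly P c = 0")
    case True
    then obtain P Q where "(P, Q) \<in> poly_pairs R" "P \<noteq> 0" "poly P c = 0"
      by blast
    thus ?thesis
      by (rule conjugate_exists_algebraic)
  next
    case False
    thus ?thesis
      by (intro conjugate_exists_transcendental[OF assms]) metis
  qed
  then obtain d where d: "\<And>P Q. (P, Q) \<in> poly_pairs R \<Longrightarrow> poly P c = 0 \<longleftrightarrow> poly Q d = 0"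
    by blast
  define R' where "R' = (\<lambda>(P, Q). (poly P c, poly Q d)) ` poly_pairs R"
  have R'I: "(poly P c, poly Q d) \<in> R'" if "(P, Q) \<in> poly_pairs R" for P Q
    using that by (force simp: R'_def)
  have R'E: "\<exists>P Q. (P, Q) \<in> poly_pairs R \<and> x = poly P c \<and> y = poly Q d" if "(x, y) \<in> R'" for x y
    using that by (force simp: R'_def)
  have sub: "R \<subseteq> R'"
    using R'I[OF poly_pairs_const] by force
  have "partial_iso R'"
  proof
    show "(1, 1) \<in> R'"
      using one sub by auto
    fix x y assume "(x, y) \<in> R'"
    then obtain P Q where PQ: "(P, Q) \<in> poly_pairs R" "x = poly P c" "y = poly Q d"
      using R'E by blast
    show "(- x, - y) \<in> R'"
      using R'I[OF poly_pairs_uminus[OF PQ(1)]] PQ by simp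
    show "x = 0 \<longleftrightarrow> y = 0"
      using PQ d by simp
    fix x' y' assume "(x', y') \<in> R'"
    then obtain P' Q' where PQ': "(P', Q') \<in> poly_pairs R" "x' = poly P' c" "y' = poly Q' d"
      using R'E by blast
    show "(x + x', y + y') \<in> R'"
      using R'I[OF poly_pairs_add[OF PQ(1) PQ'(1)]] PQ PQ' by simp
    show "(x * x', y * y') \<in> R'"
      using R'I[OF poly_pairs_mult[OF PQ(1) PQ'(1)]] PQ PQ' by simp
  qed
  moreover have "countable R'"
    unfolding R'_def using countable_poly_pairs[OF assms] by auto
  moreover have "(c, d) \<in> R'"
    using R'I[OF poly_pairs_monom[OF one, of 1]] by (simp add: poly_monom)
  ultimately show ?thesis
    using sub by blast
qed

end

lemma partial_iso_extend:
  assumes "finite C" "partial_iso R" "countable R"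
  shows "\<exists>R'. partial_iso R' \<and> countable R' \<and> R \<subseteq> R' \<and> C \<subseteq> Domain R'"
  using assms
proof (induction C rule: finite_induct)
  case empty
  thus ?case by (intro exI[of _ R]) simp
next
  case (insert c C)
  then obtain R' where R': "partial_iso R'" "countable R'" "R \<subseteq> R'" "C \<subseteq> Domain R'"
    by blast
  obtain d R'' where R'': "partial_iso R''" "countable R''" "R' \<subseteq> R''" "(c, d) \<in> R''"
    using partial_iso.extend_one[OF R'(1,2), of c] by blast
  have "R \<subseteq> R''" "insert c C \<subseteq> Domain R''"
    using R'(3) R''(3,4) Domain_mono[OF R''(3)] R'(4) by auto
  with R''(1,2) show ?case
    by (intro exI[of _ R''] conjI)
qed


section \<open>Fibres of the logarithmic Gauss map\<close>

text \<open>
  The logarithmic derivatives as explicit polynomial expressions, which ring isomorphisms and the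
  inclusion of \<open>\<real>\<close> into \<open>\<complex>\<close> visibly respect.
\<close>

lemma times_partial_deriv:
  fixes G :: "('m::finite, real) mpoly" and x :: "'k::real_normed_field ^ 'm"
  shows "x $ i * partial_deriv G i x =
    (\<Sum>\<alpha>\<in>Poly_Mapping.keys G. of_real (Poly_Mapping.lookup G \<alpha>) *
       (of_nat (Poly_Mapping.lookup \<alpha> i) * (\<Prod>j\<in>UNIV. x $ j ^ Poly_Mapping.lookup \<alpha> j)))"
proof -
  let ?e = "Poly_Mapping.lookup"
  let ?r = "\<lambda>\<alpha>. \<Prod>j\<in>UNIV - {i}. x $ j ^ ?e \<alpha> j"
  have "(\<Prod>j\<in>UNIV. (if j = i then z else x $ j) ^ ?e \<alpha> j) = z ^ ?e \<alpha> i * ?r \<alpha>"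
    for \<alpha> :: "'m \<Rightarrow>\<^sub>0 nat" and z
    by (subst prod.remove[of _ i]) auto
  hence *: "mpeval G (\<chi> j. if j = i then z else x $ j) =
      (\<Sum>\<alpha>\<in>Poly_Mapping.keys G. of_real (?e G \<alpha>) * (z ^ ?e \<alpha> i * ?r \<alpha>))" for z
    by (simp add: mpeval_def)
  have "((\<lambda>z. \<Sum>\<alpha>\<in>Poly_Mapping.keys G. of_real (?e G \<alpha>) * (z ^ ?e \<alpha> i * ?r \<alpha>))
      has_field_derivative
      (\<Sum>\<alpha>\<in>Poly_Mapping.keys G. of_real (?e G \<alpha>) * (of_nat (?e \<alpha> i) * x $ i ^ (?e \<alpha> i - 1) * ?r \<alpha>)))
      (at (x $ i))"
    by (auto intro!: derivative_eq_intros sum.cong)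
  hence "partial_deriv G i x =
      (\<Sum>\<alpha>\<in>Poly_Mapping.keys G. of_real (?e G \<alpha>) * (of_nat (?e \<alpha> i) * x $ i ^ (?e \<alpha> i - 1) * ?r \<alpha>))"
    unfolding * [symmetric] by (rule DERIV_unique[OF has_partial_deriv])
  moreover have "x $ i * (of_nat (?e \<alpha> i) * x $ i ^ (?e \<alpha> i - 1) * ?r \<alpha>) =
      of_nat (?e \<alpha> i) * (\<Prod>j\<in>UNIV. x $ j ^ ?e \<alpha> j)" for \<alpha> :: "'m \<Rightarrow>\<^sub>0 nat"
    by (subst (2) prod.remove[of _ i]) (auto simp: mult_ac power_eq_if)
  ultimately show ?thesis
    by (simp only: sum_distrib_left mult.left_commute[of "x $ i"])
qed

lemma proj_point_eq_iff:
  fixes u w :: "'k::field ^ 'm"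
  assumes "w \<noteq> 0"
  shows "proj_point u = proj_point w \<longleftrightarrow> (\<exists>c. c \<noteq> 0 \<and> u = c *s w)"
proof
  assume eq: "proj_point u = proj_point w"
  have self: "v \<in> proj_point v" for v :: "'k ^ 'm"
    by (auto simp: proj_point_def intro!: image_eqI[of _ _ 1])
  have "u \<in> proj_point w" "w \<in> proj_point u"
    using self[of u] self[of w] by (simp_all add: eq)
  obtain c where c: "u = c *s w"
    using \<open>u \<in> proj_point w\<close> unfolding proj_point_def by (rule rangeE)
  obtain d where d: "w = d *s u"
    using \<open>w \<in> proj_point u\<close> unfolding proj_point_def by (rule rangeE)
  have "c \<noteq> 0"
  proof
    assume "c = 0"
    hence "u = 0"
      using c by simp
    thus False
      using d assms by simp
  qed
  with c show "\<exists>c. c \<noteq> 0 \<and> u = c *s w"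
    by blast
next
  assume "\<exists>c. c \<noteq> 0 \<and> u = c *s w"
  then obtain c where c: "c \<noteq> 0" "u = c *s w"
    by blast
  hence "a *s u = (a * c) *s w" "a *s w = (a / c) *s u" for a
    by (simp_all add: vector_smult_assoc)
  thus "proj_point u = proj_point w"
    unfolding proj_point_def by (intro equalityI image_subsetI) (metis rangeI)+
qed

lemma log_gauss_eq_iff:
  assumes "w \<noteq> 0"
  shows "log_gauss G x = proj_point w \<longleftrightarrow> (\<exists>c. c \<noteq> 0 \<and> (\<forall>i. x $ i * partial_deriv G i x = c * w $ i))"
  unfolding log_gauss_def proj_point_eq_iff[OF assms] by (simp add: vec_eq_iff)

definition fibre :: "('m::finite, real) mpoly \<Rightarrow> 'k::real_normed_field ^ 'm \<Rightarrow> ('k ^ 'm) set" where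
  "fibre G w = {x \<in> torus_zeros G. log_gauss G x = proj_point w}"

text \<open>
  With the scalar as a witness, lying in a fibre becomes a system of polynomial equations and
  inequations, which ring isomorphisms preserve.
\<close>

lemma in_fibre_iff:
  assumes "w \<noteq> 0"
  shows "x \<in> fibre G w \<longleftrightarrow> (\<forall>i. x $ i \<noteq> 0) \<and> mpeval G x = 0 \<and>
    (\<exists>c. c \<noteq> 0 \<and> (\<forall>i. x $ i * partial_deriv G i x = c * w $ i))"
  by (simp add: fibre_def torus_zeros_def torus_def log_gauss_eq_iff[OF assms])

text \<open>
  Testing on finite subsets covers infinite sets as well, and an isomorphism can be extended only to
  finitely many numbers at a time.
\<close>

lemma num_elems_le:
  assumes "\<And>X. finite X \<Longrightarrow> X \<subseteq> A \<Longrightarrow> \<exists>f. inj_on f X \<and> f ` X \<subseteq> B"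
  shows "num_elems A \<le> num_elems B"
proof (cases "finite B")
  case True
  have card: "card X \<le> card B" if "finite X" "X \<subseteq> A" for X
    using assms[OF that] True card_inj_on_le by blast
  have "finite A"
  proof (rule ccontr)
    assume "infinite A"
    then obtain X where "X \<subseteq> A" "finite X" "card X = Suc (card B)"
      using infinite_arbitrarily_large by blast
    thus False
      using card[of X] by simp
  qed
  with card[of A] True show ?thesis
    by (simp add: num_elems_def emeasure_count_space)
qed (simp add: num_elems_def emeasure_count_space)

definition complexify :: "real ^ 'm \<Rightarrow> complex ^ 'm" where
  "complexify x = (\<chi> i. complex_of_real (x $ i))"

lemma fibre_real_le_complex:
  assumes "w \<noteq> 0"
  shows "num_elems (fibre G w) \<le> num_elems (fibre G (complexify w))"
proof (rule num_elems_le, intro exI conjI)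
  fix X assume X: "X \<subseteq> fibre G w"
  show "inj_on complexify X"
    by (auto intro!: inj_onI simp: complexify_def vec_eq_iff)
  have cw: "complexify w \<noteq> 0"
    using assms by (simp add: complexify_def vec_eq_iff)
  have ev: "mpeval G (complexify x) = of_real (mpeval G x)" for x
    by (simp add: mpeval_def complexify_def)
  have pd: "complexify x $ i * partial_deriv G i (complexify x) = of_real (x $ i * partial_deriv G i x)" for x i
    unfolding times_partial_deriv by (simp add: complexify_def)
  show "complexify ` X \<subseteq> fibre G (complexify w)"
  proof
    fix y assume "y \<in> complexify ` X"
    then obtain x where y: "y = complexify x" and "x \<in> fibre G w"
      using X by blast
    then obtain c where x: "\<forall>i. x $ i \<noteq> 0" "mpeval G x = 0" "c \<noteq> 0"
      "\<And>i. x $ i * partial_deriv G i x = c * w $ i"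
      by (auto simp: in_fibre_iff[OF assms])
    have "\<forall>i. y $ i * partial_deriv G i y = of_real c * complexify w $ i"
      unfolding y pd x(4) by (simp add: complexify_def)
    moreover have "mpeval G y = 0" "\<forall>i. y $ i \<noteq> 0"
      using x(1,2) by (simp_all add: y ev) (simp add: complexify_def)
    ultimately show "y \<in> fibre G (complexify w)"
      using x(3) by (auto simp: in_fibre_iff[OF cw] intro!: exI[of _ "of_real c"])
  qed
qed

text \<open>
  An isomorphism of countable subrings that fixes the coefficients of \<open>G\<close> and sends \<open>w\<close> to \<open>w'\<close> extends to the
  coordinates of any finite set of points over \<open>w\<close>, together with the scalars witnessing that they
  lie over \<open>w\<close>. The images solve the equations of the fibre over \<open>w'\<close> and remain distinct.
\<close>

lemma fibre_transfer:
  fixes G :: "('m::finite, real) mpoly" and w w' :: "complex ^ 'm"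
  assumes R: "partial_iso R" "countable R"
    and coeffs: "\<And>\<alpha>. (of_real (Poly_Mapping.lookup G \<alpha>), of_real (Poly_Mapping.lookup G \<alpha>)) \<in> R"
    and ww': "\<And>i. (w $ i, w' $ i) \<in> R"
    and "w \<noteq> 0"
  shows "num_elems (fibre G w) \<le> num_elems (fibre G w')"
proof (rule num_elems_le)
  fix X assume X: "finite X" "X \<subseteq> fibre G w"
  have "\<exists>c. c \<noteq> 0 \<and> (\<forall>i. x $ i * partial_deriv G i x = c * w $ i)" if "x \<in> X" for x
    using X(2) that by (auto simp: in_fibre_iff[OF \<open>w \<noteq> 0\<close>])
  then obtain c where c: "c x \<noteq> 0" "x $ i * partial_deriv G i x = c x * w $ i" if "x \<in> X" for x i
    by metis
  obtain S where S: "partial_iso S" "R \<subseteq> S"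
    and dom: "c ` X \<union> (\<lambda>(x, i). x $ i) ` (X \<times> UNIV) \<subseteq> Domain S"
    using partial_iso_extend[OF _ R, of "c ` X \<union> (\<lambda>(x, i). x $ i) ` (X \<times> UNIV)"] X(1) by auto
  interpret partial_iso S by fact
  have "\<forall>a\<in>Domain S. \<exists>b. (a, b) \<in> S"
    by blast
  then obtain \<tau> where \<tau>: "(a, \<tau> a) \<in> S" if "a \<in> Domain S" for a
    by metis
  have c_\<tau>: "(c x, \<tau> (c x)) \<in> S" if "x \<in> X" for x
    using that dom by (intro \<tau>) auto
  define h where "h x = (\<chi> i. \<tau> (x $ i))" for x :: "complex ^ 'm"
  have h: "(x $ i, h x $ i) \<in> S" if "x \<in> X" for x i
  proof -
    have "x $ i \<in> (\<lambda>(x, i). x $ i) ` (X \<times> UNIV)"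
      using that by force
    hence "x $ i \<in> Domain S"
      using dom by blast
    thus ?thesis
      by (simp add: h_def \<tau>)
  qed
  have "inj_on h X"
  proof (rule inj_onI)
    fix x y assume "x \<in> X" "y \<in> X" "h x = h y"
    thus "x = y"
      using eq_iff[OF h h] by (simp add: vec_eq_iff)
  qed
  moreover have "h x \<in> fibre G w'" if x: "x \<in> X" for x
  proof -
    have x0: "x $ i \<noteq> 0" "mpeval G x = 0" for i
      using x X(2) by (auto simp: in_fibre_iff[OF \<open>w \<noteq> 0\<close>])
    have "w' \<noteq> 0"
      using zero_iff[OF subsetD[OF S(2) ww']] \<open>w \<noteq> 0\<close> by (simp add: vec_eq_iff)
    have "(mpeval G x, mpeval G (h x)) \<in> S"
      unfolding mpeval_def using coeffs S(2) h[OF x] by (intro sum mult prod power) auto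
    hence "mpeval G (h x) = 0"
      using zero_iff[of "mpeval G x" "mpeval G (h x)"] x0(2) by simp
    moreover have "h x $ i \<noteq> 0" for i
      using zero_iff[OF h[OF x]] x0(1) by simp
    moreover have "h x $ i * partial_deriv G i (h x) = \<tau> (c x) * w' $ i" for i
    proof -
      have "(x $ i * partial_deriv G i x, h x $ i * partial_deriv G i (h x)) \<in> S"
        unfolding times_partial_deriv using coeffs S(2) h[OF x]
        by (intro sum mult prod power of_nat) auto
      moreover have "(c x * w $ i, \<tau> (c x) * w' $ i) \<in> S"
        using ww' S(2) c_\<tau>[OF x] by (intro mult) auto
      ultimately show ?thesis
        using eq_iff c(2)[OF x] by metis
    qed
    moreover have "\<tau> (c x) \<noteq> 0"
      using zero_iff[OF c_\<tau>[OF x]] c(1)[OF x] by simp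
    ultimately show ?thesis
      unfolding in_fibre_iff[OF \<open>w' \<noteq> 0\<close>] by blast
  qed
  ultimately show "\<exists>f. inj_on f X \<and> f ` X \<subseteq> fibre G w'"
    by blast
qed


section \<open>Polynomial functions and generic vectors\<close>

text \<open>
  For \<open>K\<close> containing \<open>-1\<close>, which provides negatives, these are the polynomial functions with
  coefficients in the ring generated by \<open>K\<close>.
\<close>

inductive_set poly_funs :: "complex set \<Rightarrow> (complex ^ 'm \<Rightarrow> complex) set" for K where
  const: "c \<in> K \<Longrightarrow> (\<lambda>_. c) \<in> poly_funs K"
| coord: "(\<lambda>w. w $ i) \<in> poly_funs K"
| add: "f \<in> poly_funs K \<Longrightarrow> g \<in> poly_funs K \<Longrightarrow> (\<lambda>w. f w + g w) \<in> poly_funs K"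
| mult: "f \<in> poly_funs K \<Longrightarrow> g \<in> poly_funs K \<Longrightarrow> (\<lambda>w. f w * g w) \<in> poly_funs K"

text \<open>
  Exhaust the polynomial functions by the countable stages that arise from iterating
  all sums and products.
\<close>

lemma countable_poly_funs:
  assumes "countable K"
  shows "countable (poly_funs K :: (complex ^ 'm::finite \<Rightarrow> complex) set)"
proof -
  define B :: "(complex ^ 'm \<Rightarrow> complex) set" where "B = (\<lambda>c _. c) ` K \<union> range (\<lambda>i w. w $ i)"
  define step :: "(complex ^ 'm \<Rightarrow> complex) set \<Rightarrow> (complex ^ 'm \<Rightarrow> complex) set" where
    "step S = S \<union> (\<lambda>(f, g) w. f w + g w) ` (S \<times> S) \<union> (\<lambda>(f, g) w. f w * g w) ` (S \<times> S)" for S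
  define U where "U k = (step ^^ k) B" for k
  have U_Suc: "U (Suc k) = step (U k)" for k
    by (simp add: U_def)
  have "countable (U k)" for k
  proof (induction k)
    case 0
    show ?case
      using assms by (auto simp: U_def B_def countable_finite)
  next
    case (Suc k)
    thus ?case
      unfolding U_Suc step_def by (intro countable_Un countable_image countable_SIGMA) auto
  qed
  moreover have "poly_funs K \<subseteq> (\<Union>k. U k)"
  proof
    have mono: "U k \<subseteq> U l" if "k \<le> l" for k l
      using that by (rule lift_Suc_mono_le[of U, rotated]) (auto simp: U_Suc step_def)
    fix f :: "complex ^ 'm \<Rightarrow> complex" assume "f \<in> poly_funs K"
    thus "f \<in> (\<Union>k. U k)"
    proof induction
      case (const c)
      thus ?case by (auto simp: U_def B_def intro!: exI[of _ 0])
    next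
      case (coord i)
      thus ?case by (auto simp: U_def B_def intro!: exI[of _ 0])
    next
      case (add f g)
      then obtain k l where "f \<in> U k" "g \<in> U l"
        by blast
      hence "(f, g) \<in> U (max k l) \<times> U (max k l)"
        using mono[of k "max k l"] mono[of l "max k l"] by auto
      hence "(\<lambda>w. f w + g w) \<in> U (Suc (max k l))"
        unfolding U_Suc step_def by (auto intro!: image_eqI[of _ _ "(f, g)"])
      thus ?case by blast
    next
      case (mult f g)
      then obtain k l where "f \<in> U k" "g \<in> U l"
        by blast
      hence "(f, g) \<in> U (max k l) \<times> U (max k l)"
        using mono[of k "max k l"] mono[of l "max k l"] by auto
      hence "(\<lambda>w. f w * g w) \<in> U (Suc (max k l))"
        unfolding U_Suc step_def by (auto intro!: image_eqI[of _ _ "(f, g)"])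
      thus ?case by blast
    qed
  qed
  ultimately show ?thesis
    by (intro countable_subset[of "poly_funs K" "\<Union>k. U k"]) auto
qed

lemma continuous_on_poly_funs: "f \<in> poly_funs K \<Longrightarrow> continuous_on S f"
  by (induction rule: poly_funs.induct) (auto intro!: continuous_intros)

lemma poly_funs_on_line:
  assumes "f \<in> poly_funs K"
  shows "\<exists>p. \<forall>z. f (a + z *s b) = poly p z"
  using assms
proof induction
  case (const c)
  show ?case by (intro exI[of _ "[:c:]"]) simp
next
  case (coord i)
  show ?case by (intro exI[of _ "[:a $ i, b $ i:]"]) simp
next
  case (add f g)
  thus ?case by (metis poly_add)
next
  case (mult f g)
  thus ?case by (metis poly_mult)
qed

text \<open>
  For \<open>K\<close> containing \<open>-1\<close> this says that the coordinates of \<open>w\<close> are algebraically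
  independent over the ring generated by \<open>K\<close>.
\<close>

definition generic :: "complex set \<Rightarrow> complex ^ 'm \<Rightarrow> bool" where
  "generic K w \<longleftrightarrow> (\<forall>f\<in>poly_funs K. (\<exists>z. f z \<noteq> 0) \<longrightarrow> f w \<noteq> 0)"

text \<open>
  Polynomials over \<open>K\<close> vanish at a generic vector only if they vanish identically, a condition that
  does not depend on the vector. Evaluation at \<open>w\<close> and at \<open>w'\<close> thus gives isomorphic rings.
\<close>

lemma generic_partial_iso:
  assumes "generic K w" "generic K w'" "1 \<in> K" "- 1 \<in> K"
  shows "partial_iso ((\<lambda>f. (f w, f w')) ` poly_funs K)"
proof
  let ?R = "(\<lambda>f. (f w, f w')) ` poly_funs K"
  have I: "(f w, f w') \<in> ?R" if "f \<in> poly_funs K" for f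
    using that by blast
  show "(1, 1) \<in> ?R"
    using I[OF poly_funs.const[OF assms(3)]] .
  fix x y assume "(x, y) \<in> ?R"
  then obtain f where f: "f \<in> poly_funs K" "x = f w" "y = f w'"
    by blast
  show "(- x, - y) \<in> ?R"
    using I[OF poly_funs.mult[OF poly_funs.const[OF assms(4)] f(1)]] f by simp
  show "x = 0 \<longleftrightarrow> y = 0"
    using assms(1,2) f unfolding generic_def by metis
  fix x' y' assume "(x', y') \<in> ?R"
  then obtain g where g: "g \<in> poly_funs K" "x' = g w" "y' = g w'"
    by blast
  show "(x + x', y + y') \<in> ?R"
    using I[OF poly_funs.add[OF f(1) g(1)]] f g by simp
  show "(x * x', y * y') \<in> ?R"
    using I[OF poly_funs.mult[OF f(1) g(1)]] f g by simp
qed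


section \<open>Almost every line contains a generic vector\<close>

lemma scaleR_vec_conv_scalar_mult:
  fixes x :: "'k::real_normed_field ^ 'm"
  shows "r *\<^sub>R x = of_real r *s x"
  unfolding vec_eq_iff vector_scaleR_component vector_smult_component
  by (simp only: scaleR_conv_of_real) simp

lemma AE_imp_ex:
  assumes "AE x in M. P x" and "emeasure M (space M) \<noteq> 0"
  shows "\<exists>x. P x"
proof (rule ccontr)
  assume "\<not> (\<exists>x. P x)"
  with assms(1) have "AE x in M. False"
    by simp
  with assms(2) show False
    by (simp add: AE_iff_null null_sets_def)
qed

text \<open>
  Consider the pairs \<open>(x, r)\<close> with \<open>g (a + r x) = 0\<close>. For fixed \<open>x\<close> the set of such \<open>r\<close> is countable, so by
  Fubini the set of such \<open>x\<close> is null for almost every \<open>r\<close>. For a single \<open>r \<noteq> 0\<close> this set is an affine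
  image of the zero set of \<open>g\<close>, which is therefore null itself.
\<close>

lemma null_set_of_countable_rays:
  fixes g :: "'a::euclidean_space \<Rightarrow> complex"
  assumes cont: "continuous_on UNIV g"
    and rays: "\<And>x. countable {r::real. g (a + r *\<^sub>R x) = 0}"
  shows "{x. g x = 0} \<in> null_sets lborel"
proof -
  have meas: "(\<lambda>x. g (a + x)) \<in> borel_measurable borel"
    by (intro borel_measurable_continuous_onI continuous_on_compose2[OF cont] continuous_intros) auto
  have "AE x in lborel :: 'a measure. AE r in (lborel :: real measure). g (a + r *\<^sub>R x) \<noteq> 0"
    using AE_not_in[OF countable_imp_null_set_lborel[OF rays]] by auto
  moreover have "{(x, r). g (a + r *\<^sub>R x) \<noteq> 0} \<inter> space (lborel \<Otimes>\<^sub>M lborel) \<in> sets (lborel \<Otimes>\<^sub>M (lborel :: real measure))"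
  proof -
    have "(\<lambda>p. g (a + snd p *\<^sub>R fst p)) \<in> borel_measurable (lborel \<Otimes>\<^sub>M (lborel :: real measure))"
      by (rule measurable_compose[OF _ meas]) measurable
    hence "{p \<in> space (lborel \<Otimes>\<^sub>M (lborel :: real measure)). g (a + snd p *\<^sub>R fst p) \<noteq> 0}
        \<in> sets (lborel \<Otimes>\<^sub>M lborel)"
      by measurable
    also have "{p \<in> space (lborel \<Otimes>\<^sub>M (lborel :: real measure)). g (a + snd p *\<^sub>R fst p) \<noteq> 0} =
        {(x, r). g (a + r *\<^sub>R x) \<noteq> 0} \<inter> space (lborel \<Otimes>\<^sub>M lborel)"
      by auto
    finally show ?thesis .
  qed
  ultimately have "AE r in (lborel :: real measure). AE x in (lborel :: 'a measure). g (a + r *\<^sub>R x) \<noteq> 0"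
    by (subst (asm) lborel_pair.AE_commute) (auto simp: space_pair_measure split_beta')
  moreover have "AE r in (lborel :: real measure). r \<noteq> 0"
    using AE_not_in[OF countable_imp_null_set_lborel[of "{0 :: real}"]] by simp
  ultimately have "AE r in (lborel :: real measure). r \<noteq> 0 \<and> (AE x in lborel. g (a + r *\<^sub>R x) \<noteq> 0)"
    by eventually_elim simp
  from AE_imp_ex[OF this] obtain r where r: "r \<noteq> 0" "AE x in lborel. g (a + r *\<^sub>R x) \<noteq> 0"
    by auto
  have "{x. g (a + r *\<^sub>R x) = 0} \<in> null_sets lborel"
  proof -
    have "{x \<in> space lborel. \<not> g (a + r *\<^sub>R x) \<noteq> 0} \<in> sets lborel"
      using measurable_compose[OF _ meas, of "\<lambda>x. r *\<^sub>R x" lborel] by measurable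
    with r(2) show ?thesis
      by (subst (asm) AE_iff_null) auto
  qed
  hence "negligible {x. g (a + r *\<^sub>R x) = 0}"
    by (simp add: negligible_iff_null_sets null_sets_completionI)
  hence "negligible ((\<lambda>x. a + r *\<^sub>R x) ` {x. g (a + r *\<^sub>R x) = 0})"
    by (rule negligible_differentiable_image_negligible[OF order_refl])
      (auto intro!: derivative_intros simp: differentiable_on_def)
  moreover have "(\<lambda>x. a + r *\<^sub>R x) ` {x. g (a + r *\<^sub>R x) = 0} = {x. g x = 0}"
  proof (intro equalityI subsetI)
    fix x assume "x \<in> {x. g x = 0}"
    thus "x \<in> (\<lambda>x. a + r *\<^sub>R x) ` {x. g (a + r *\<^sub>R x) = 0}"
      using r(1) by (intro image_eqI[of _ _ "(x - a) /\<^sub>R r"]) auto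
  qed auto
  moreover have "closed {x. g x = 0}"
    using continuous_closed_preimage_constant[OF cont, of 0] by simp
  ultimately show ?thesis
    by (simp add: negligible_iff_null_sets null_sets_completion_iff borel_closed)
qed

text \<open>
  The lines on which \<open>g\<close> vanishes identically form a cone contained in the zero set of \<open>g\<close>.
  Quantifying over the whole line, and not just over one unit vector on it, is what makes the
  condition independent of the representative.
\<close>

lemma AE_proj_measure_ex_nonzero:
  fixes g :: "'k::{real_normed_field, euclidean_space} ^ 'm::finite \<Rightarrow> complex"
  assumes cont: "continuous_on UNIV g" and null: "{v. g v = 0} \<in> null_sets lborel"
  shows "AE \<beta> in proj_measure. \<exists>v\<in>\<beta>. g v \<noteq> 0"
proof -
  define A where "A = {\<beta> \<in> proj_space. \<forall>v\<in>\<beta>. g v = 0}"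
  define W where "W = {v \<in> sphere 0 1. proj_point v \<in> A}"
  have W_eq: "W = sphere 0 1 \<inter> (\<Inter>c. {v. g (c *s v) = 0})"
  proof -
    have "v \<noteq> 0" if "v \<in> sphere 0 1" for v :: "'k ^ 'm"
      using that by auto
    thus ?thesis
      by (auto simp: W_def A_def proj_point_def intro!: proj_point_in_proj_space[unfolded proj_point_def])
  qed
  have "continuous_on UNIV (\<lambda>v. g (c *s v))" for c
    unfolding vector_scalar_mult_def
    by (intro continuous_on_compose2[OF cont] continuous_intros) auto
  hence "closed {v. g (c *s v) = 0}" for c
    using continuous_closed_preimage_constant[of UNIV "\<lambda>v. g (c *s v)" 0] by simp
  hence "closed W"
    unfolding W_eq by (intro closed_Int closed_INT) auto
  hence W: "W \<in> sets borel"
    by (rule borel_closed)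
  have A_alg: "A \<in> sets proj_algebra"
    unfolding proj_algebra_def using W
    by (subst sets_measure_of) (auto simp: A_def W_def intro!: sigma_sets.Basic)
  have W_sph: "proj_point -` A \<inter> space sphere_measure = W"
    by (auto simp: W_def space_sphere_measure)
  let ?B = "ball 0 1 - {0 :: 'k ^ 'm}"
  \<comment> \<open>The surface measure of \<open>W\<close> is a multiple of the volume of the part of the ball lying over it.\<close>
  have "sgn -` W \<inter> ?B \<subseteq> {v. g v = 0}"
  proof
    fix v assume v: "v \<in> sgn -` W \<inter> ?B"
    have "v = of_real (norm v) *s sgn v"
      using v by (simp add: sgn_div_norm flip: scaleR_vec_conv_scalar_mult)
    moreover have "g (of_real (norm v) *s sgn v) = 0"
      using v unfolding W_eq by blast
    ultimately show "v \<in> {v. g v = 0}"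
      by (metis mem_Collect_eq)
  qed
  moreover have "sgn -` W \<inter> ?B \<in> sets lborel"
  proof -
    have "sgn \<in> borel_measurable (borel :: ('k ^ 'm) measure)"
      unfolding sgn_div_norm by measurable
    from measurable_sets[OF this W] show ?thesis
      by (auto simp: vimage_def)
  qed
  ultimately have sgn0: "emeasure lborel (sgn -` W \<inter> ?B) = 0"
    using null null_sets_subset[OF null] by (metis null_setsD1)
  have "W \<in> sets (restrict_space borel (sphere 0 1))"
    using W by (auto simp: sets_restrict_space W_def image_iff intro!: bexI[of _ W])
  hence "emeasure sphere_measure W = ennreal (real DIM('k ^ 'm)) *
      emeasure (restrict_space lborel ?B) (sgn -` W \<inter> space (restrict_space lborel ?B))"
    unfolding sphere_measure_def emeasure_scale_measure
    by (subst emeasure_distr[OF measurable_sgn_sphere]) auto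
  also have "\<dots> = 0"
    using sgn0 by (simp add: space_restrict_space emeasure_restrict_space)
  finally have "emeasure sphere_measure W = 0" .
  hence "emeasure proj_measure A = 0"
    unfolding proj_measure_def emeasure_scale_measure
    by (subst emeasure_distr[OF measurable_proj_point A_alg]) (simp add: W_sph)
  moreover have "A \<in> sets proj_measure"
    using A_alg by (simp add: proj_measure_def)
  ultimately have "A \<in> null_sets proj_measure"
    by blast
  thus ?thesis
    by (rule AE_I') (auto simp: A_def space_proj_measure)
qed

text \<open>
  On almost every line each of the countably many functions takes a nonzero value somewhere. It then
  has only countably many zeros there, whereas the line has uncountably many points.
\<close>

lemma AE_line_has_common_nonzero:
  fixes F :: "('k::{real_normed_field, euclidean_space} ^ 'm::finite \<Rightarrow> complex) set"
  assumes "countable F"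
    and cont: "\<And>g. g \<in> F \<Longrightarrow> continuous_on UNIV g"
    and nonzero: "\<And>g. g \<in> F \<Longrightarrow> \<exists>a. g a \<noteq> 0"
    and lines: "\<And>g a b. g \<in> F \<Longrightarrow> g a \<noteq> 0 \<Longrightarrow> countable {z. g (a + z *s b) = 0}"
  shows "AE \<beta> in proj_measure. \<exists>v. v \<noteq> 0 \<and> \<beta> = proj_point v \<and> (\<forall>g\<in>F. g v \<noteq> 0)"
proof -
  have "AE \<beta> in proj_measure. \<exists>v\<in>\<beta>. g v \<noteq> 0" if g: "g \<in> F" for g
  proof (rule AE_proj_measure_ex_nonzero[OF cont[OF g]])
    obtain a where a: "g a \<noteq> 0"
      using nonzero[OF g] by blast
    have "countable {r. g (a + r *\<^sub>R x) = 0}" for x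
    proof -
      have "of_real ` {r. g (a + r *\<^sub>R x) = 0} \<subseteq> {z. g (a + z *s x) = 0}"
        by (auto simp: scaleR_vec_conv_scalar_mult)
      from countable_subset[OF this lines[OF g a]] show ?thesis
        by (simp add: countable_image_inj_eq inj_on_def)
    qed
    thus "{v. g v = 0} \<in> null_sets lborel"
      by (rule null_set_of_countable_rays[OF cont[OF g]])
  qed
  hence "AE \<beta> in proj_measure. \<forall>g\<in>F. \<exists>v\<in>\<beta>. g v \<noteq> 0"
    using \<open>countable F\<close> by (simp add: AE_ball_countable)
  moreover have "AE \<beta> in (proj_measure :: ('k ^ 'm) set measure). \<beta> \<in> proj_space"
    using AE_space[of "proj_measure :: ('k ^ 'm) set measure"] by (simp add: space_proj_measure)
  ultimately show ?thesis
  proof eventually_elim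
    case (elim \<beta>)
    then obtain u where u: "u \<noteq> 0" "\<beta> = proj_point u"
      by (auto simp: proj_space_def)
    have "countable {z. g (z *s u) = 0}" if g: "g \<in> F" for g
    proof -
      obtain z0 where "g (z0 *s u) \<noteq> 0"
        using elim(1) g u(2) by (force simp: proj_point_def)
      from lines[OF g this] have "countable ((\<lambda>z. z0 + z) ` {z. g (z0 *s u + z *s u) = 0})"
        by (rule countable_image)
      moreover have "{z. g (z *s u) = 0} \<subseteq> (\<lambda>z. z0 + z) ` {z. g (z0 *s u + z *s u) = 0}"
      proof
        fix z assume "z \<in> {z. g (z *s u) = 0}"
        thus "z \<in> (\<lambda>z. z0 + z) ` {z. g (z0 *s u + z *s u) = 0}"
          by (intro image_eqI[of _ _ "z - z0"]) (auto simp flip: vector_sadd_rdistrib)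
      qed
      ultimately show ?thesis
        by (rule countable_subset[rotated])
    qed
    hence "countable ({0} \<union> (\<Union>g\<in>F. {z. g (z *s u) = 0}))"
      using \<open>countable F\<close> by auto
    moreover have "uncountable (UNIV :: 'k set)"
    proof
      assume "countable (UNIV :: 'k set)"
      hence "countable (range (of_real :: real \<Rightarrow> 'k))"
        by (rule countable_subset[rotated]) auto
      thus False
        using uncountable_UNIV_real by (simp add: countable_image_inj_eq inj_on_def)
    qed
    ultimately obtain z where z: "z \<notin> {0} \<union> (\<Union>g\<in>F. {z. g (z *s u) = 0})"
      by (metis UNIV_eq_I)
    hence "proj_point (z *s u) = proj_point u"
      using u(1) by (auto simp: proj_point_eq_iff)
    moreover have "z *s u \<noteq> 0"
      using z u(1) by (auto simp: vec_eq_iff)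
    ultimately show ?case
      using z u(2) by (intro exI[of _ "z *s u"]) auto
  qed
qed

lemma AE_complex_line_generic:
  assumes "countable K"
  shows "AE \<beta> in (complex_proj_measure :: (complex ^ 'm::finite) set measure).
    \<exists>w. w \<noteq> 0 \<and> \<beta> = proj_point w \<and> generic K w"
proof -
  let ?F = "{f \<in> poly_funs K. \<exists>z :: complex ^ 'm. f z \<noteq> 0}"
  have "AE \<beta> in proj_measure. \<exists>w. w \<noteq> 0 \<and> \<beta> = proj_point w \<and> (\<forall>g\<in>?F. g w \<noteq> 0)"
  proof (rule AE_line_has_common_nonzero)
    show "countable ?F"
      using countable_poly_funs[OF assms] by (rule countable_subset[rotated]) auto
    show "countable {z. g (a + z *s b) = 0}" if "g \<in> ?F" "g a \<noteq> 0" for g a and b :: "complex ^ 'm"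
    proof -
      obtain p where p: "\<And>z. g (a + z *s b) = poly p z"
        using poly_funs_on_line[of g K a b] \<open>g \<in> ?F\<close> by auto
      from p[of 0] that(2) have "p \<noteq> 0"
        by auto
      thus ?thesis
        by (simp add: p poly_roots_finite countable_finite)
    qed
  qed (auto intro: continuous_on_poly_funs)
  thus ?thesis
    by eventually_elim (auto simp: generic_def)
qed

lemma complexify_line: "complexify (a + r *s b) = complexify a + complex_of_real r *s complexify b"
  by (simp add: complexify_def vec_eq_iff)

text \<open>
  A nonzero polynomial function on \<open>\<complex>^m\<close> cannot vanish at all real points: writing a point where it
  does not vanish as \<open>a + \<i> b\<close> with real \<open>a\<close> and \<open>b\<close>, the polynomial \<open>z \<mapsto> f (a + z b)\<close> is not zero
  and so has only finitely many real roots.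
\<close>

lemma AE_real_line_generic:
  assumes "countable K"
  shows "AE \<beta> in (real_proj_measure :: (real ^ 'm::finite) set measure).
    \<exists>v. v \<noteq> 0 \<and> \<beta> = proj_point v \<and> generic K (complexify v)"
proof -
  let ?F = "(\<lambda>f v. f (complexify v)) ` {f \<in> poly_funs K. \<exists>z :: complex ^ 'm. f z \<noteq> 0}"
  have "AE \<beta> in proj_measure. \<exists>v. v \<noteq> 0 \<and> \<beta> = proj_point v \<and> (\<forall>g\<in>?F. g v \<noteq> 0)"
  proof (rule AE_line_has_common_nonzero)
    show "countable ?F"
      using countable_poly_funs[OF assms] by (intro countable_image) (rule countable_subset[rotated], auto)
    fix g assume "g \<in> ?F"
    then obtain f w where f: "f \<in> poly_funs K" "f w \<noteq> 0" "g = (\<lambda>v. f (complexify v))"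
      by blast
    show "continuous_on UNIV g"
      unfolding f(3) complexify_def
      by (rule continuous_on_compose2[OF continuous_on_poly_funs[OF f(1)]]) (auto intro!: continuous_intros)
    have finite_roots: "finite {r. g (a + r *s b) = 0}" if "f (complexify a + z *s complexify b) \<noteq> 0" for a b z
    proof -
      obtain p where p: "\<And>z. f (complexify a + z *s complexify b) = poly p z"
        using poly_funs_on_line[OF f(1)] by blast
      with that have "p \<noteq> 0"
        by auto
      hence "finite (complex_of_real -` {z. poly p z = 0})"
        by (intro finite_vimageI poly_roots_finite) (auto simp: inj_on_def)
      thus ?thesis
        by (simp add: f(3) complexify_line p vimage_def)
    qed
    show "countable {r. g (a + r *s b) = 0}" if "g a \<noteq> 0" for a b
      using finite_roots[of a 0 b] that by (simp add: f(3) countable_finite)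
    define a b where "a = (\<chi> i. Re (w $ i))" and "b = (\<chi> i. Im (w $ i))"
    have "w = complexify a + \<i> *s complexify b"
      by (simp add: a_def b_def complexify_def vec_eq_iff complex_eq_iff)
    hence "finite {r. g (a + r *s b) = 0}"
      using finite_roots[of a \<i> b] f(2) by simp
    hence "{r. g (a + r *s b) = 0} \<noteq> UNIV"
      using infinite_UNIV_char_0[where 'a = real] by metis
    thus "\<exists>a. g a \<noteq> 0"
      by blast
  qed
  thus ?thesis
    by eventually_elim (auto simp: generic_def)
qed


section \<open>The generic number of preimages and the curvature inequality\<close>

text \<open>
  The coefficients together with what is needed to generate a ring; \<open>0\<close> is included so that
  the coefficients of absent monomials belong to the set as well.
\<close>

definition coefficients :: "('m, real) mpoly \<Rightarrow> complex set" where
  "coefficients G = {0, 1, - 1} \<union> (\<lambda>\<alpha>. of_real (Poly_Mapping.lookup G \<alpha>)) ` Poly_Mapping.keys G"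

lemma countable_coefficients: "countable (coefficients G)"
  by (simp add: coefficients_def countable_finite)

lemma lookup_in_coefficients: "of_real (Poly_Mapping.lookup G \<alpha>) \<in> coefficients G"
  by (cases "\<alpha> \<in> Poly_Mapping.keys G") (auto simp: coefficients_def in_keys_iff)

lemma generic_fibre_le:
  fixes G :: "('m::finite, real) mpoly" and w w' :: "complex ^ 'm"
  assumes gen: "generic (coefficients G) w" "generic (coefficients G) w'" and "w \<noteq> 0"
  shows "num_elems (fibre G w) \<le> num_elems (fibre G w')"
proof (rule fibre_transfer[where R = "(\<lambda>f. (f w, f w')) ` poly_funs (coefficients G)"])
  let ?K = "coefficients G"
  show "partial_iso ((\<lambda>f. (f w, f w')) ` poly_funs ?K)"
    by (rule generic_partial_iso[OF gen]) (auto simp: coefficients_def)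
  show "countable ((\<lambda>f. (f w, f w')) ` poly_funs ?K)"
    by (intro countable_image countable_poly_funs countable_coefficients)
  show "(of_real (Poly_Mapping.lookup G \<alpha>), of_real (Poly_Mapping.lookup G \<alpha>))
      \<in> (\<lambda>f. (f w, f w')) ` poly_funs ?K" for \<alpha>
    by (rule image_eqI[OF _ poly_funs.const[OF lookup_in_coefficients[of G \<alpha>]]]) simp
  show "(w $ i, w' $ i) \<in> (\<lambda>f. (f w, f w')) ` poly_funs ?K" for i
    by (rule image_eqI[OF _ poly_funs.coord[of i]]) simp
qed fact

text \<open>
  The number \<open>N\<close> plays the role of the degree of the logarithmic Gauss map. The two almost-everywhere statements
  concern different measures, but both come from the same countable family of polynomials,
  so a generic real direction is a generic complex one.
\<close>

lemma generic_fibre_count: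
  fixes G :: "('m::finite, real) mpoly"
  obtains N where
    "AE \<beta> in (complex_proj_measure :: (complex ^ 'm) set measure).
       num_elems {x \<in> torus_zeros G. log_gauss G x = \<beta>} = N"
    "AE \<beta> in (real_proj_measure :: (real ^ 'm) set measure).
       num_elems {x \<in> torus_zeros G. log_gauss G x = \<beta>} \<le> N"
proof -
  let ?K = "coefficients G"
  note AE_C = AE_complex_line_generic[OF countable_coefficients[of G], where 'm = 'm]
  note AE_R = AE_real_line_generic[OF countable_coefficients[of G], where 'm = 'm]
  have "emeasure (complex_proj_measure :: (complex ^ 'm) set measure) (space proj_measure) \<noteq> 0"
    unfolding space_proj_measure emeasure_proj_measure ennreal_eq_0_iff not_le
    by (intro divide_pos_pos sphere_vol_pos)
  from AE_imp_ex[OF AE_C this] obtain w0 :: "complex ^ 'm" where w0: "w0 \<noteq> 0" "generic ?K w0"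
    by blast
  have count: "num_elems (fibre G w) = num_elems (fibre G w0)" if "w \<noteq> 0" "generic ?K w" for w
    using generic_fibre_le[of G w w0] generic_fibre_le[of G w0 w] that w0
    by (intro antisym) simp_all
  show ?thesis
  proof
    show "AE \<beta> in (complex_proj_measure :: (complex ^ 'm) set measure).
       num_elems {x \<in> torus_zeros G. log_gauss G x = \<beta>} = num_elems (fibre G w0)"
      using AE_C by eventually_elim (auto simp: count simp flip: fibre_def)
    show "AE \<beta> in (real_proj_measure :: (real ^ 'm) set measure).
       num_elems {x \<in> torus_zeros G. log_gauss G x = \<beta>} \<le> num_elems (fibre G w0)"
      using AE_R
    proof eventually_elim
      case (elim \<beta>)
      then obtain v where v: "v \<noteq> 0" "\<beta> = proj_point v" "generic ?K (complexify v)"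
        by blast
      have "complexify v \<noteq> 0"
        using v(1) by (simp add: complexify_def vec_eq_iff)
      thus ?case
        using fibre_real_le_complex[OF v(1), of G] count v(3)
        by (simp add: v(2) flip: fibre_def)
    qed
  qed
qed

theorem theorem3p13:
  fixes G :: "('m::finite, real) mpoly" and n :: nat and t :: real
  assumes "CARD('m) = n + 1" and "n \<ge> 1"
    and "0 < t" and "t < 1"
    and "G \<noteq> 0" and "completely_nondegenerate G"
  shows "ereal (sphere_vol (2 * n) / sphere_vol n) * real_total_abs_curvature G
           \<le> complex_total_abs_curvature G"
proof -
  let ?f = "\<lambda>\<beta> :: (real ^ 'm) set. num_elems {x \<in> torus_zeros G. log_gauss G x = \<beta>}"
  let ?g = "\<lambda>\<beta> :: (complex ^ 'm) set. num_elems {x \<in> torus_zeros G. log_gauss G x = \<beta>}"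
  obtain N where N: "AE \<beta> in complex_proj_measure. ?g \<beta> = N" "AE \<beta> in real_proj_measure. ?f \<beta> \<le> N"
    by (rule generic_fibre_count)
  have pos: "sphere_vol k > 0" for k
    by (rule sphere_vol_pos)
  have "(\<integral>\<^sup>+ \<beta>. ?f \<beta> \<partial>real_proj_measure) \<le> (\<integral>\<^sup>+ \<beta>. N \<partial>(real_proj_measure :: (real ^ 'm) set measure))"
    by (rule nn_integral_mono_AE[OF N(2)])
  also have "\<dots> = N * ennreal (sphere_vol n / 2)"
    by (simp add: space_proj_measure emeasure_proj_measure_real[OF assms(1)])
  finally have real: "real_total_abs_curvature G \<le> enn2ereal N * ereal (sphere_vol n / 2)"
    unfolding real_total_abs_curvature_def using pos[of n]
    by (simp add: less_eq_ennreal.rep_eq times_ennreal.rep_eq)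
  have "(\<integral>\<^sup>+ \<beta>. ?g \<beta> \<partial>complex_proj_measure) = (\<integral>\<^sup>+ \<beta>. N \<partial>(complex_proj_measure :: (complex ^ 'm) set measure))"
    by (rule nn_integral_cong_AE[OF N(1)])
  also have "\<dots> = N * ennreal (sphere_vol (2 * n + 1) / sphere_vol 1)"
    by (simp add: space_proj_measure emeasure_proj_measure_complex[OF assms(1)])
  finally have complex: "enn2ereal (\<integral>\<^sup>+ \<beta>. ?g \<beta> \<partial>complex_proj_measure)
      = enn2ereal N * ereal (sphere_vol (2 * n + 1) / sphere_vol 1)"
    using pos by (simp add: times_ennreal.rep_eq less_imp_le)
  have sign: "(- 1) ^ n * ((- 1) ^ n * x) = x" for x :: ereal
  proof (cases "even n")
    case False
    thus ?thesis by (cases x) auto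
  qed auto
  have "sphere_vol 1 = 2 * pi"
    by (simp add: sphere_vol_def)
  hence const: "curv_const n * (sphere_vol (2 * n + 1) / sphere_vol 1) = sphere_vol (2 * n) / 2"
    using pos[of "2 * n + 1"] by (simp add: curv_const_def field_simps)
  \<comment> \<open>After normalisation both sides are compared with \<open>N\<close> times half the volume of the sphere of
    dimension \<open>2 n\<close>.\<close>
  have "ereal (sphere_vol (2 * n) / sphere_vol n) * real_total_abs_curvature G
      \<le> ereal (sphere_vol (2 * n) / sphere_vol n) * (enn2ereal N * ereal (sphere_vol n / 2))"
    using real pos by (intro ereal_mult_left_mono) (simp_all add: less_imp_le)
  also have "\<dots> = enn2ereal N * (ereal (sphere_vol (2 * n) / sphere_vol n) * ereal (sphere_vol n / 2))"
    by (simp only: mult.left_commute)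
  also have "ereal (sphere_vol (2 * n) / sphere_vol n) * ereal (sphere_vol n / 2)
      = ereal (curv_const n) * ereal (sphere_vol (2 * n + 1) / sphere_vol 1)"
  proof -
    have "sphere_vol (2 * n) / sphere_vol n * (sphere_vol n / 2) = sphere_vol (2 * n) / 2"
      using pos[of n] by simp
    thus ?thesis
      by (simp only: times_ereal.simps const)
  qed
  also have "enn2ereal N * \<dots> = complex_total_abs_curvature G"
    unfolding complex_total_abs_curvature_def complex_total_curvature_def Let_def
    by (simp only: assms(1) add_diff_cancel_right' complex mult.assoc sign mult.left_commute)
  finally show ?thesis .
qed

end
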